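(* Let $d$ be an even positive integer and let $f$ be a form of degree $d$ in $n$ variables. Then $H_f(x)\succ0$ for all $x\ne0$ if and only if there exist $c>0$ and $r\in\mathbb{N}$ such that $f(x)-c\big(\sum_{i} x_i^2\big)^{d/2}$ is $r$-sos-convex. Furthermore, this condition can be imposed using semidefinite programming.
   Context: A form is a homogeneous polynomial. $H_f(x)$ is the Hessian of $f$ at $x$, and $\succ0$ means positive definite. For a nonnegative integer $r$, a polynomial $g$ in $n$ variables is called $r$-sos-convex if the polynomial $y^TH_g(x)y\cdot(\sum_{i=1}^n x_i^2)^r$ in the variables $(x,y)$ is a sum of squares of polynomials. *)

theory Defs
  imports "HOL-Analysis.Analysis" "HOL-Library.Poly_Mapping"
begin

text \<open>
  A monomial is its exponent vector, and a polynomial is a finitely supported family of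
  coefficients indexed by monomials. Ring operations are those of
  \<^theory>\<open>HOL-Library.Poly_Mapping\<close> (multiplication is convolution). The variables are the
  elements of a finite type; for a polynomial in \<open>n\<close> variables this is a type with \<open>n\<close> elements.
\<close>

type_synonym 'v monomial = "'v \<Rightarrow>\<^sub>0 nat"
type_synonym 'v rpoly = "('v \<Rightarrow>\<^sub>0 nat) \<Rightarrow>\<^sub>0 real"

definition mdeg :: "'v::finite monomial \<Rightarrow> nat" where
  "mdeg m = (\<Sum>i\<in>UNIV. Poly_Mapping.lookup m i)"

definition monomials_of_degree :: "nat \<Rightarrow> 'v::finite monomial set" where
  "monomials_of_degree d = {m. mdeg m = d}"

definition Const :: "real \<Rightarrow> 'v rpoly" where
  "Const c = Poly_Mapping.single 0 c"

definition Var :: "'v \<Rightarrow> 'v rpoly" where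
  "Var i = Poly_Mapping.single (Poly_Mapping.single i 1) 1"

text \<open>As usual, the zero polynomial counts as a form of every degree.\<close>

definition is_form :: "nat \<Rightarrow> 'v::finite rpoly \<Rightarrow> bool" where
  "is_form d f \<longleftrightarrow> (\<forall>m\<in>Poly_Mapping.keys f. mdeg m = d)"

text \<open>
  Substitution of elements of a commutative ring for the variables, where \<open>h\<close> maps the
  coefficients into that ring.
\<close>

definition subst_poly ::
    "(real \<Rightarrow> 'a::comm_ring_1) \<Rightarrow> ('v::finite \<Rightarrow> 'a) \<Rightarrow> 'v rpoly \<Rightarrow> 'a" where
  "subst_poly h a p = (\<Sum>m\<in>Poly_Mapping.keys p.
     h (Poly_Mapping.lookup p m) * (\<Prod>i\<in>UNIV. a i ^ Poly_Mapping.lookup m i))"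

definition eval_poly :: "('v::finite \<Rightarrow> real) \<Rightarrow> 'v rpoly \<Rightarrow> real" where
  "eval_poly = subst_poly (\<lambda>c. c)"

text \<open>
  Formal partial derivative. If \<open>i\<close> does not occur in \<open>m\<close>, the truncated subtraction on exponents
  is harmless because the coefficient is zero. That this is the analytic partial derivative
  is lemma \<open>has_real_derivative_eval_poly\<close> below.
\<close>

definition partial_deriv :: "'v \<Rightarrow> 'v rpoly \<Rightarrow> 'v rpoly" where
  "partial_deriv i p = (\<Sum>m\<in>Poly_Mapping.keys p.
     Poly_Mapping.single (m - Poly_Mapping.single i 1)
       (real (Poly_Mapping.lookup m i) * Poly_Mapping.lookup p m))"

definition hessian_poly :: "'n rpoly \<Rightarrow> 'n rpoly ^ 'n ^ 'n" where
  "hessian_poly f = (\<chi> i j. partial_deriv i (partial_deriv j f))"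

definition hessian :: "'n::finite rpoly \<Rightarrow> real ^ 'n \<Rightarrow> real ^ 'n ^ 'n" where
  "hessian f x = (\<chi> i j. eval_poly (($) x) (hessian_poly f $ i $ j))"

definition pos_def :: "real ^ 'n ^ 'n \<Rightarrow> bool" where
  "pos_def A \<longleftrightarrow> transpose A = A \<and> (\<forall>y. y \<noteq> 0 \<longrightarrow> y \<bullet> (A *v y) > 0)"

definition sos :: "'v rpoly \<Rightarrow> bool" where
  "sos p \<longleftrightarrow> (\<exists>qs :: 'v rpoly list. p = (\<Sum>q\<leftarrow>qs. q\<^sup>2))"

definition sq_norm_poly :: "'n::finite rpoly" where
  "sq_norm_poly = (\<Sum>i\<in>UNIV. (Var i)\<^sup>2)"

text \<open>
  The \<open>2n\<close> variables \<open>(x, y)\<close> are indexed by \<^typ>\<open>'n + 'n\<close>: \<open>x i\<close> is \<^term>\<open>Var (Inl i)\<close>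
  and \<open>y i\<close> is \<^term>\<open>Var (Inr i)\<close>. The map \<open>in_x\<close> reads a polynomial in \<open>x\<close> as one in \<open>(x, y)\<close>.
\<close>

definition in_x :: "'n::finite rpoly \<Rightarrow> ('n + 'n) rpoly" where
  "in_x = subst_poly Const (\<lambda>i. Var (Inl i))"

definition hessian_form :: "'n::finite rpoly \<Rightarrow> ('n + 'n) rpoly" where
  "hessian_form g = (\<Sum>i\<in>UNIV. \<Sum>j\<in>UNIV.
     Var (Inr i) * in_x (hessian_poly g $ i $ j) * Var (Inr j))"

definition r_sos_convex :: "nat \<Rightarrow> 'n::finite rpoly \<Rightarrow> bool" where
  "r_sos_convex r g \<longleftrightarrow> sos (hessian_form g * (in_x sq_norm_poly) ^ r)"

text \<open>
  Matrices of varying size \<open>N\<close> are functions on indices; only the entries below \<open>N\<close> matter.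
\<close>

definition psd :: "nat \<Rightarrow> (nat \<Rightarrow> nat \<Rightarrow> real) \<Rightarrow> bool" where
  "psd N X \<longleftrightarrow> (\<forall>i<N. \<forall>j<N. X i j = X j i) \<and>
     (\<forall>v :: nat \<Rightarrow> real. (\<Sum>i<N. \<Sum>j<N. v i * X i j * v j) \<ge> 0)"

text \<open>
  \<open>S\<close> is a subset of the coordinate space \<open>\<real>\<^sup>K\<close> (families vanishing outside the finite set \<open>K\<close>).
  It can be imposed by semidefinite programming if membership of \<open>u\<close> is the feasibility of an SDP
  in standard form: a positive semidefinite matrix variable \<open>X\<close>, subject to finitely many affine
  equations in \<open>X\<close> and \<open>u\<close> jointly, namely \<open>\<langle>A k, X\<rangle> + \<langle>B k, u\<rangle> = b k\<close>.
  The size \<open>N\<close> and the data \<open>A\<close>, \<open>B\<close>, \<open>b\<close> do not depend on \<open>u\<close>.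
\<close>

definition sdp_representable :: "'k set \<Rightarrow> ('k \<Rightarrow> real) set \<Rightarrow> bool" where
  "sdp_representable K S \<longleftrightarrow> finite K \<and>
     (\<exists>(N::nat) (M::nat) (A :: nat \<Rightarrow> nat \<Rightarrow> nat \<Rightarrow> real) (B :: nat \<Rightarrow> 'k \<Rightarrow> real) (b :: nat \<Rightarrow> real).
        S = {u. (\<forall>\<kappa>. \<kappa> \<notin> K \<longrightarrow> u \<kappa> = 0) \<and>
               (\<exists>X. psd N X \<and>
                 (\<forall>k<M. (\<Sum>i<N. \<Sum>j<N. A k i j * X i j) + (\<Sum>\<kappa>\<in>K. B k \<kappa> * u \<kappa>) = b k))})"

lemma eval_poly_superset:
  assumes "finite S" "Poly_Mapping.keys p \<subseteq> S"
  shows "eval_poly a p = (\<Sum>m\<in>S.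
     Poly_Mapping.lookup p m * (\<Prod>i\<in>UNIV. a i ^ Poly_Mapping.lookup m i))"
  unfolding eval_poly_def subst_poly_def using assms
  by (intro sum.mono_neutral_left) (auto simp: in_keys_iff)

lemma eval_poly_zero [simp]: "eval_poly a 0 = 0"
  by (simp add: eval_poly_def subst_poly_def)

lemma eval_poly_single [simp]:
  "eval_poly a (Poly_Mapping.single m c) = c * (\<Prod>i\<in>UNIV. a i ^ Poly_Mapping.lookup m i)"
  by (subst eval_poly_superset[of "{m}"]) auto

lemma eval_poly_add: "eval_poly a (p + q) = eval_poly a p + eval_poly a q"
proof -
  let ?S = "Poly_Mapping.keys p \<union> Poly_Mapping.keys q"
  have "Poly_Mapping.keys (p + q) \<subseteq> ?S"
    by (rule Poly_Mapping.keys_add)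
  then show ?thesis
    by (simp add: eval_poly_superset[of ?S] lookup_add algebra_simps sum.distrib)
qed

lemma eval_poly_sum: "eval_poly a (\<Sum>s\<in>S. f s) = (\<Sum>s\<in>S. eval_poly a (f s))"
  by (induction S rule: infinite_finite_induct) (auto simp: eval_poly_add)

lemma has_real_derivative_eval_poly:
  fixes a :: "'v::finite \<Rightarrow> real"
  shows "((\<lambda>t. eval_poly (a(i := t)) p) has_real_derivative
     eval_poly a (partial_deriv i p)) (at (a i))"
proof -
  let ?P = "\<lambda>m. \<Prod>j\<in>UNIV - {i}. a j ^ Poly_Mapping.lookup m j"
  have split: "(\<Prod>j\<in>UNIV. (b j :: real)) = b i * (\<Prod>j\<in>UNIV - {i}. b j)" for b
    by (simp add: prod.remove[of UNIV i])
  have 1: "eval_poly (a(i := t)) p = (\<Sum>m\<in>Poly_Mapping.keys p.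
      Poly_Mapping.lookup p m * (t ^ Poly_Mapping.lookup m i * ?P m))" for t
    unfolding eval_poly_def subst_poly_def split
    by (intro sum.cong refl arg_cong2[of _ _ _ _ "(*)"] prod.cong) auto
  have P: "(\<Prod>j\<in>UNIV - {i}. a j ^ (Poly_Mapping.lookup m j -
      Poly_Mapping.lookup (Poly_Mapping.single i (Suc 0)) j)) = ?P m" for m
    by (intro prod.cong) (auto simp: lookup_single)
  have 2: "eval_poly a (partial_deriv i p) = (\<Sum>m\<in>Poly_Mapping.keys p.
      Poly_Mapping.lookup p m *
        (real (Poly_Mapping.lookup m i) * a i ^ (Poly_Mapping.lookup m i - 1) * ?P m))"
    unfolding partial_deriv_def eval_poly_sum
    by (intro sum.cong refl) (simp add: split P lookup_minus)
  show ?thesis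
    unfolding 1 2 by (auto intro!: derivative_eq_intros sum.cong)
qed

end

theory Submission
  imports Defs "HOL-Computational_Algebra.Polynomial"
begin

text \<open>
  Write \<open>d = 2k\<close> and \<open>n\<close> for the number of variables. If \<open>f - c |x|\<^sup>d\<close> is \<open>r\<close>-sos-convex, then its
  Hessian is positive semidefinite at every \<open>x \<noteq> 0\<close>, while the Hessian of \<open>c |x|\<^sup>d\<close> is positive
  definite there; so the Hessian of \<open>f\<close> is positive definite (\<open>hess_quad_pos_if_r_sos_convex\<close>).

  For the converse, compactness of the spheres gives a \<open>c > 0\<close> such that the Hessian \<open>F\<close> of
  \<open>f - c |x|\<^sup>d\<close> is still positive definite away from \<open>0\<close> (\<open>hess_quad_margin\<close>). It remains to see that a
  positive definite matrix of forms, multiplied by a large power of \<open>|x|\<^sup>2\<close>, is a combination of squares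
  of polynomials with positive semidefinite constant matrices as coefficients
  (\<open>positive_matrix_form_times_norm_power\<close>). This is reduced to Polya's theorem on the simplex.
  The squares \<open>(x\<^sub>i + x\<^sub>j)\<^sup>2\<close> and \<open>(x\<^sub>i - x\<^sub>j)\<^sup>2\<close> are taken as new nonnegative variables \<open>y\<close>, with
  \<open>\<Sum>\<^sub>k y\<^sub>k = 4n |x|\<^sup>2\<close>. The entries of \<open>F\<close> are forms in \<open>y\<close>, and \<open>F\<close> is positive definite on the
  part of the simplex that comes from vectors \<open>x\<close>. That part is the zero set of a sum of squares of
  polynomials in \<open>y\<close>, and adding to \<open>F\<close> a large multiple of it, times the identity matrix, gives a
  matrix of forms \<open>F'\<close> that is positive definite on the whole simplex.
  Polya's theorem, uniformly over the unit vectors \<open>v\<close> of the quadratic forms (\<open>polya_uniform\<close>), then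
  makes the coefficients of \<open>(\<Sum>\<^sub>k y\<^sub>k)\<^sup>N F'\<close> positive semidefinite. Substituting back
  turns \<open>F'\<close> into \<open>F\<close>, up to a power of \<open>|x|\<^sup>2\<close>, and every monomial in \<open>y\<close> into a square.

  For the semidefinite representation, the product of \<open>|x|\<^sup>2\<^sup>r\<close> with the Hessian form \<open>v\<^sup>T H(x) v\<close> is
  a form in \<open>(x, v)\<close> of the fixed degree \<open>2e = d + 2r\<close>. It is a sum of squares
  if and only if it equals \<open>z\<^sup>T G z\<close> with a positive semidefinite Gram matrix \<open>G\<close>, where \<open>z\<close> lists
  the monomials of degree \<open>e\<close> (\<open>sos_iff_gram_matrix\<close>). The coefficients depend linearly on \<open>f\<close> and \<open>c\<close>, and \<open>c > 0\<close> is expressed by a positive semidefinite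
  \<open>2 \<times> 2\<close> block with diagonal \<open>c, t\<close> and off-diagonal entries \<open>1\<close>.
\<close>

section \<open>Polynomials as functions\<close>

lemma rpoly_expand:
  "p = (\<Sum>m\<in>Poly_Mapping.keys p. Poly_Mapping.single m (Poly_Mapping.lookup p m))"
  by (rule poly_mapping_eqI) (auto simp: lookup_sum lookup_single when_def in_keys_iff)

lemma rpoly_induct [case_names single add]:
  assumes single: "\<And>m c. P (Poly_Mapping.single m c)"
    and add: "\<And>p q. P p \<Longrightarrow> P q \<Longrightarrow> P (p + q)"
  shows "P (p :: 'v rpoly)"
proof -
  have "P 0"
    using single[of 0 0] by simp
  have "P (\<Sum>m\<in>S. Poly_Mapping.single m (Poly_Mapping.lookup p m))" if "finite S" for S
    using that by induction (auto intro: \<open>P 0\<close> single add)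
  then show ?thesis
    by (subst rpoly_expand) simp
qed

lemma lookup_Const_mult [simp]:
  "Poly_Mapping.lookup (Const c * p) m = c * Poly_Mapping.lookup p m"
  by (induction p rule: rpoly_induct)
     (auto simp: Const_def mult_single lookup_single when_def lookup_add algebra_simps)

lemma eval_poly_mult: "eval_poly a (p * q) = eval_poly a p * eval_poly a q"
proof (induction p rule: rpoly_induct)
  case (single m c)
  show ?case
    by (induction q rule: rpoly_induct)
       (auto simp: mult_single lookup_add power_add prod.distrib eval_poly_add algebra_simps)
qed (simp add: distrib_right eval_poly_add)

lemma eval_poly_Const [simp]: "eval_poly a (Const c) = c"
  by (simp add: Const_def)

lemma eval_poly_one [simp]: "eval_poly a 1 = 1"
  using eval_poly_Const[of a 1] by (simp add: Const_def)

lemma eval_poly_Var [simp]: "eval_poly a (Var i) = a i"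
proof -
  have "a j ^ Poly_Mapping.lookup (Poly_Mapping.single i 1) j = (if j = i then a i else 1)" for j
    by (auto simp: lookup_single when_def)
  then show ?thesis
    by (simp add: Var_def)
qed

lemma eval_poly_power: "eval_poly a (p ^ k) = eval_poly a p ^ k"
  by (induction k) (auto simp: eval_poly_mult)

lemma eval_poly_prod: "eval_poly a (\<Prod>s\<in>S. f s) = (\<Prod>s\<in>S. eval_poly a (f s))"
  by (induction S rule: infinite_finite_induct) (auto simp: eval_poly_mult)

lemma eval_poly_diff: "eval_poly a (p - q) = eval_poly a p - eval_poly a q"
  using eval_poly_add[of a "p - q" q] by simp

lemma eval_poly_sum_list: "eval_poly a (\<Sum>q\<leftarrow>qs. f q) = (\<Sum>q\<leftarrow>qs. eval_poly a (f q))"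
  by (induction qs) (auto simp: eval_poly_add)

lemmas eval_poly_simps =
  eval_poly_add eval_poly_diff eval_poly_mult eval_poly_power eval_poly_sum eval_poly_prod

lemma eval_in_x: "eval_poly a (in_x p) = eval_poly (\<lambda>i. a (Inl i)) p"
  by (simp add: in_x_def subst_poly_def[of Const] eval_poly_simps)
     (simp add: eval_poly_def subst_poly_def)

lemma eval_sq_norm_poly: "eval_poly a sq_norm_poly = (\<Sum>i\<in>UNIV. (a i)\<^sup>2)"
  by (simp add: sq_norm_poly_def eval_poly_simps)

lemma lookup_partial_deriv:
  "Poly_Mapping.lookup (partial_deriv i p) m =
     real (Suc (Poly_Mapping.lookup m i)) * Poly_Mapping.lookup p (m + Poly_Mapping.single i 1)"
proof -
  have eq: "k - Poly_Mapping.single i 1 = m \<and> Poly_Mapping.lookup k i \<noteq> 0 \<longleftrightarrow>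
      k = m + Poly_Mapping.single i 1" for k :: "'a monomial"
    by (auto simp: poly_mapping_eq_iff fun_eq_iff lookup_add lookup_minus lookup_single when_def
        split: if_splits)
  have "Poly_Mapping.lookup (partial_deriv i p) m = (\<Sum>k\<in>Poly_Mapping.keys p.
      if k = m + Poly_Mapping.single i 1
      then real (Poly_Mapping.lookup k i) * Poly_Mapping.lookup p k else 0)"
    unfolding partial_deriv_def lookup_sum
  proof (intro sum.cong refl)
    fix k
    show "Poly_Mapping.lookup (Poly_Mapping.single (k - Poly_Mapping.single i 1)
            (real (Poly_Mapping.lookup k i) * Poly_Mapping.lookup p k)) m =
          (if k = m + Poly_Mapping.single i 1
           then real (Poly_Mapping.lookup k i) * Poly_Mapping.lookup p k else 0)"
      using eq[of k] by (cases "Poly_Mapping.lookup k i = 0") (auto simp: lookup_single when_def)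
  qed
  then show ?thesis
    by (auto simp: in_keys_iff lookup_add)
qed

lemma mdeg_zero_iff: "mdeg m = 0 \<longleftrightarrow> m = 0"
  by (auto simp: mdeg_def poly_mapping_eq_iff fun_eq_iff)

lemma mdeg_add: "mdeg (m + n) = mdeg m + mdeg n"
  by (simp add: mdeg_def lookup_add sum.distrib)

lemma mdeg_single [simp]: "mdeg (Poly_Mapping.single i k) = k"
  by (simp add: mdeg_def lookup_single when_def)

lemma mdeg_pos_split:
  assumes "mdeg m = Suc k"
  obtains i m' where "m = m' + Poly_Mapping.single i 1" "mdeg m' = k"
proof -
  obtain i where i: "Poly_Mapping.lookup m i \<noteq> 0"
    using assms by (force simp: mdeg_def)
  have "m = (m - Poly_Mapping.single i 1) + Poly_Mapping.single i 1"
    using i by (auto simp: poly_mapping_eq_iff fun_eq_iff lookup_add lookup_minus lookup_single when_def)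
  then show ?thesis
    using assms that by (metis Suc_eq_plus1 add_right_cancel mdeg_add mdeg_single)
qed

text \<open>
  Pointwise vanishing passes to all partial derivatives, and the coefficient of a monomial is, up to
  a factorial factor, the value at the origin of the corresponding iterated derivative. So a
  polynomial that vanishes everywhere is zero, and polynomial identities may be proved pointwise.
\<close>

lemma eval_poly_zero_imp_lookup_zero:
  fixes p :: "'v::finite rpoly"
  assumes "\<And>a. eval_poly a p = 0"
  shows "Poly_Mapping.lookup p m = 0"
  using assms
proof (induction "mdeg m" arbitrary: m p)
  case 0
  have "eval_poly (\<lambda>_. 0) p = (\<Sum>k\<in>Poly_Mapping.keys p. if k = 0 then Poly_Mapping.lookup p k else 0)"
    unfolding eval_poly_def subst_poly_def
  proof (intro sum.cong refl)
    fix k :: "'v monomial"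
    show "Poly_Mapping.lookup p k * (\<Prod>i\<in>UNIV. 0 ^ Poly_Mapping.lookup k i) =
        (if k = 0 then Poly_Mapping.lookup p k else 0)"
      by (auto simp: poly_mapping_eq_iff fun_eq_iff zero_power)
  qed
  then have "Poly_Mapping.lookup p 0 = 0"
    using 0 by (auto simp: in_keys_iff split: if_splits)
  then show ?case
    using 0 mdeg_zero_iff[of m] by simp
next
  case (Suc k)
  obtain i m' where m: "m = m' + Poly_Mapping.single i 1" "mdeg m' = k"
    using Suc.hyps(2) mdeg_pos_split by metis
  have "eval_poly a (partial_deriv i p) = 0" for a
    using DERIV_unique[OF has_real_derivative_eval_poly[of a i p], of 0] Suc.prems by simp
  then have "Poly_Mapping.lookup (partial_deriv i p) m' = 0"
    using Suc.hyps(1)[of m' "partial_deriv i p"] m by simp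
  then show ?case
    using m by (simp add: lookup_partial_deriv)
qed

lemma eval_poly_inject:
  fixes p q :: "'v::finite rpoly"
  assumes "\<And>a. eval_poly a p = eval_poly a q"
  shows "p = q"
proof (rule poly_mapping_eqI)
  fix m
  have "Poly_Mapping.lookup (p - q) m = 0"
    by (rule eval_poly_zero_imp_lookup_zero) (simp add: eval_poly_diff assms)
  then show "Poly_Mapping.lookup p m = Poly_Mapping.lookup q m"
    by (simp add: lookup_minus)
qed

section \<open>Forms\<close>

lemma is_form_lookup: "is_form d f \<longleftrightarrow> (\<forall>m. mdeg m \<noteq> d \<longrightarrow> Poly_Mapping.lookup f m = 0)"
  by (auto simp: is_form_def in_keys_iff)

lemma is_form_zero [simp]: "is_form d 0"
  by (simp add: is_form_def)

lemma is_form_add: "is_form d p \<Longrightarrow> is_form d q \<Longrightarrow> is_form d (p + q)"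
  by (simp add: is_form_lookup lookup_add)

lemma is_form_diff: "is_form d p \<Longrightarrow> is_form d q \<Longrightarrow> is_form d (p - q)"
  by (simp add: is_form_lookup lookup_minus)

lemma is_form_sum: "(\<And>s. s \<in> S \<Longrightarrow> is_form d (f s)) \<Longrightarrow> is_form d (\<Sum>s\<in>S. f s)"
  by (induction S rule: infinite_finite_induct) (auto intro: is_form_add)

lemma is_form_mult: "is_form d p \<Longrightarrow> is_form e q \<Longrightarrow> is_form (d + e) (p * q)"
  using keys_mult[of p q] by (fastforce simp: is_form_def mdeg_add)

lemma is_form_Const [simp]: "is_form 0 (Const c)"
  by (auto simp: is_form_def Const_def mdeg_zero_iff split: if_splits)

lemma is_form_one [simp]: "is_form 0 1"
  using is_form_Const[of 1] by (simp add: Const_def)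

lemma is_form_Var [simp]: "is_form 1 (Var i)"
  by (auto simp: is_form_def Var_def)

lemma is_form_power: "is_form d p \<Longrightarrow> is_form (k * d) (p ^ k)"
  by (induction k) (auto intro: is_form_mult)

lemma is_form_prod:
  "(\<And>s. s \<in> S \<Longrightarrow> is_form (d s) (f s)) \<Longrightarrow> is_form (\<Sum>s\<in>S. d s) (\<Prod>s\<in>S. f s)"
  by (induction S rule: infinite_finite_induct) (auto intro: is_form_mult)

lemma is_form_in_x: "is_form d p \<Longrightarrow> is_form d (in_x p)"
  unfolding in_x_def subst_poly_def
proof (rule is_form_sum)
  fix m assume "is_form d p" "m \<in> Poly_Mapping.keys p"
  have "is_form (mdeg m) (\<Prod>i\<in>UNIV. Var (Inl i) ^ Poly_Mapping.lookup m i)"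
    unfolding mdeg_def by (rule is_form_prod) (use is_form_power[OF is_form_Var] in auto)
  from is_form_mult[OF is_form_Const this] and \<open>is_form d p\<close> \<open>m \<in> _\<close>
  show "is_form d (Const (Poly_Mapping.lookup p m) *
      (\<Prod>i\<in>UNIV. Var (Inl i) ^ Poly_Mapping.lookup m i))"
    by (auto simp: is_form_def)
qed

lemma is_form_partial_deriv: "is_form d p \<Longrightarrow> is_form (d - 1) (partial_deriv i p)"
  by (auto simp: is_form_lookup lookup_partial_deriv mdeg_add)

lemma is_form_sq_norm_poly: "is_form 2 (sq_norm_poly :: 'n::finite rpoly)"
  unfolding sq_norm_poly_def
  by (rule is_form_sum) (use is_form_power[OF is_form_Var, of 2] in simp)

lemma is_form_sq_norm_poly_power: "is_form (2 * k) ((sq_norm_poly :: 'n::finite rpoly) ^ k)"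
  using is_form_power[OF is_form_sq_norm_poly, of k] by (simp add: mult.commute)

lemma eval_form_scale:
  assumes "is_form d p"
  shows "eval_poly (\<lambda>i. t * a i) p = t ^ d * eval_poly a p"
proof -
  have "Poly_Mapping.lookup p m * (\<Prod>i\<in>UNIV. (t * a i) ^ Poly_Mapping.lookup m i) =
        t ^ d * (Poly_Mapping.lookup p m * (\<Prod>i\<in>UNIV. a i ^ Poly_Mapping.lookup m i))"
    if "m \<in> Poly_Mapping.keys p" for m
  proof -
    have "(\<Prod>i\<in>UNIV. t ^ Poly_Mapping.lookup m i) = t ^ d"
      using that assms by (auto simp: is_form_def mdeg_def power_sum)
    then show ?thesis
      by (simp add: power_mult_distrib prod.distrib algebra_simps)
  qed
  then show ?thesis
    unfolding eval_poly_def subst_poly_def sum_distrib_left by (intro sum.cong refl)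
qed

lemma continuous_on_eval_poly [continuous_intros]:
  assumes "\<And>i. continuous_on S (\<lambda>s. a s i)"
  shows "continuous_on S (\<lambda>s. eval_poly (a s) p)"
  unfolding eval_poly_def subst_poly_def by (intro continuous_intros assms)

section \<open>Hessians\<close>

lemma partial_deriv_add: "partial_deriv i (p + q) = partial_deriv i p + partial_deriv i q"
  by (rule poly_mapping_eqI) (simp add: lookup_partial_deriv lookup_add algebra_simps)

lemma partial_deriv_diff: "partial_deriv i (p - q) = partial_deriv i p - partial_deriv i q"
  by (rule poly_mapping_eqI) (simp add: lookup_partial_deriv lookup_minus algebra_simps)

lemma partial_deriv_Const_mult: "partial_deriv i (Const c * p) = Const c * partial_deriv i p"
  by (rule poly_mapping_eqI) (simp add: lookup_partial_deriv)

lemma partial_deriv_commute: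
  "partial_deriv i (partial_deriv j p) = partial_deriv j (partial_deriv i p)"
  by (rule poly_mapping_eqI)
     (auto simp: lookup_partial_deriv lookup_add lookup_single when_def add_ac)

text \<open>
  By uniqueness of derivatives, formal differentiation may be computed analytically. The product
  rule and the derivative of the powers of \<^term>\<open>sq_norm_poly\<close> follow from the rules of calculus.
\<close>

lemma partial_deriv_eqI:
  fixes q :: "'v::finite rpoly"
  assumes "\<And>a. ((\<lambda>t. eval_poly (a(i := t)) p) has_real_derivative eval_poly a q) (at (a i))"
  shows "partial_deriv i p = q"
  by (rule eval_poly_inject) (rule DERIV_unique[OF has_real_derivative_eval_poly assms])

text \<open>
  The quadratic form \<open>v\<^sup>T H\<^sub>g(x) v\<close>, on plain functions: it is both the value of
  \<^term>\<open>hessian_form g\<close> at \<open>(x, v)\<close> and what decides whether \<^term>\<open>hessian g x\<close> is positive definite.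
\<close>

definition hess_quad :: "'n::finite rpoly \<Rightarrow> ('n \<Rightarrow> real) \<Rightarrow> ('n \<Rightarrow> real) \<Rightarrow> real" where
  "hess_quad g x v = (\<Sum>i\<in>UNIV. \<Sum>j\<in>UNIV. v i * eval_poly x (partial_deriv i (partial_deriv j g)) * v j)"

lemma eval_hessian_form:
  "eval_poly a (hessian_form g) = hess_quad g (\<lambda>i. a (Inl i)) (\<lambda>i. a (Inr i))"
  by (simp add: hessian_form_def hess_quad_def hessian_poly_def eval_poly_simps eval_in_x)

lemma pos_def_hessian_iff:
  "pos_def (hessian g x) \<longleftrightarrow> (\<forall>v. v \<noteq> 0 \<longrightarrow> hess_quad g (($) x) (($) v) > 0)"
proof -
  have "transpose (hessian g x) = hessian g x"
    by (simp add: transpose_def hessian_def hessian_poly_def vec_eq_iff partial_deriv_commute)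
  moreover have "v \<bullet> (hessian g x *v v) = hess_quad g (($) x) (($) v)" for v
    by (simp add: inner_vec_def matrix_vector_mult_def hessian_def hessian_poly_def hess_quad_def
        sum_distrib_left mult.assoc)
  ultimately show ?thesis
    by (simp add: pos_def_def)
qed

lemma hess_quad_add: "hess_quad (f + g) x v = hess_quad f x v + hess_quad g x v"
  by (simp add: hess_quad_def partial_deriv_add eval_poly_add algebra_simps sum.distrib)

lemma hess_quad_diff: "hess_quad (f - g) x v = hess_quad f x v - hess_quad g x v"
  by (simp add: hess_quad_def partial_deriv_diff eval_poly_diff algebra_simps sum_subtractf)

lemma hess_quad_Const_mult: "hess_quad (Const c * f) x v = c * hess_quad f x v"
  unfolding hess_quad_def partial_deriv_Const_mult eval_poly_mult eval_poly_Const
  by (simp add: sum_distrib_left mult_ac)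

lemma hess_quad_scale:
  assumes "is_form d g"
  shows "hess_quad g (\<lambda>i. s * x i) (\<lambda>i. t * v i) = s ^ (d - 2) * t\<^sup>2 * hess_quad g x v"
proof -
  have "is_form (d - 2) (partial_deriv i (partial_deriv j g))" for i j
    using is_form_partial_deriv[OF is_form_partial_deriv[OF assms]] by (simp add: numeral_2_eq_2)
  then show ?thesis
    unfolding hess_quad_def sum_distrib_left
    by (intro sum.cong refl) (simp add: eval_form_scale[where d = "d - 2"] power2_eq_square mult_ac)
qed

lemma partial_deriv_sq_norm_power:
  "partial_deriv j (sq_norm_poly ^ k) = Const (2 * real k) * Var j * sq_norm_poly ^ (k - 1)"
proof (rule partial_deriv_eqI)
  fix a :: "'a \<Rightarrow> real"
  have "((\<lambda>t. (\<Sum>i\<in>UNIV. ((a(j := t)) i)\<^sup>2)) has_real_derivative 2 * a j) (at (a j))"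
  proof -
    have "(\<Sum>i\<in>UNIV. ((a(j := t)) i)\<^sup>2) = t\<^sup>2 + (\<Sum>i\<in>UNIV - {j}. (a i)\<^sup>2)" for t
      by (subst sum.remove[of _ j]) auto
    then show ?thesis
      by (auto intro!: derivative_eq_intros)
  qed
  from DERIV_power[OF this, of k]
  show "((\<lambda>t. eval_poly (a(j := t)) (sq_norm_poly ^ k)) has_real_derivative
     eval_poly a (Const (2 * real k) * Var j * sq_norm_poly ^ (k - 1))) (at (a j))"
    by (simp add: eval_poly_simps eval_sq_norm_poly mult_ac)
qed

lemma partial_deriv_mult:
  fixes p :: "'v::finite rpoly"
  shows "partial_deriv i (p * q) = partial_deriv i p * q + p * partial_deriv i q"
proof (rule partial_deriv_eqI)
  fix a
  show "((\<lambda>t. eval_poly (a(i := t)) (p * q)) has_real_derivative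
     eval_poly a (partial_deriv i p * q + p * partial_deriv i q)) (at (a i))"
    using DERIV_mult[OF has_real_derivative_eval_poly[of a i p] has_real_derivative_eval_poly[of a i q]]
    by (simp add: eval_poly_simps algebra_simps)
qed

lemma partial_deriv_Var:
  fixes i :: "'v::finite"
  shows "partial_deriv i (Var j) = Const (if i = j then 1 else 0)"
  by (rule partial_deriv_eqI) (auto intro!: derivative_eq_intros)

text \<open>
  This is the identity \<open>v\<^sup>T H(x) v = 2k |x|\<^sup>2\<^sup>k\<^sup>-\<^sup>2 |v|\<^sup>2 + 4k(k - 1) |x|\<^sup>2\<^sup>k\<^sup>-\<^sup>4 \<langle>x, v\<rangle>\<^sup>2\<close>
  for the Hessian of \<open>|x|\<^sup>2\<^sup>k\<close>. For \<open>k = 1\<close> the truncated exponent \<open>k - 2\<close> is harmless because of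
  the factor \<open>k - 1\<close>.
\<close>

lemma hess_quad_sq_norm_power:
  "hess_quad (sq_norm_poly ^ k) x v =
     2 * real k * (\<Sum>i\<in>UNIV. (x i)\<^sup>2) ^ (k - 1) * (\<Sum>i\<in>UNIV. (v i)\<^sup>2) +
     4 * real k * real (k - 1) * (\<Sum>i\<in>UNIV. (x i)\<^sup>2) ^ (k - 2) * (\<Sum>i\<in>UNIV. x i * v i)\<^sup>2"
proof -
  define s where "s = (\<Sum>i\<in>UNIV. (x i)\<^sup>2)"
  have s: "eval_poly x sq_norm_poly = s"
    by (simp add: eval_sq_norm_poly s_def)
  have "partial_deriv i (partial_deriv j (sq_norm_poly ^ k)) =
      Const (2 * real k) * (Const (if i = j then 1 else 0) * sq_norm_poly ^ (k - 1) +
        Var j * (Const (2 * real (k - 1)) * Var i * sq_norm_poly ^ (k - 1 - 1)))" for i j :: 'a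
    unfolding partial_deriv_sq_norm_power mult.assoc partial_deriv_Const_mult
    by (simp add: partial_deriv_sq_norm_power partial_deriv_mult partial_deriv_Var mult.assoc)
  then have ev: "v i * eval_poly x (partial_deriv i (partial_deriv j (sq_norm_poly ^ k))) * v j =
      2 * real k * s ^ (k - 1) * (if i = j then (v i)\<^sup>2 else 0) +
      4 * real k * real (k - 1) * s ^ (k - 2) * ((x i * v i) * (x j * v j))" for i j
    by (auto simp: eval_poly_simps s power2_eq_square[of "v _"] numeral_2_eq_2)
       (simp_all add: algebra_simps)
  show ?thesis
    unfolding hess_quad_def ev s_def[symmetric]
    by (simp add: sum.distrib sum_distrib_left[symmetric] power2_eq_square[of "sum _ _"] sum_product)
qed

lemma hess_quad_sq_norm_power_pos:
  assumes "k > 0" "x \<noteq> (\<lambda>_. 0)" "v \<noteq> (\<lambda>_. 0)"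
  shows "hess_quad (sq_norm_poly ^ k) x v > 0"
proof -
  have pos: "(\<Sum>i\<in>UNIV. (w i)\<^sup>2) > 0" if "w \<noteq> (\<lambda>_. 0)" for w :: "'a \<Rightarrow> real"
  proof -
    have "(\<Sum>i\<in>UNIV. (w i)\<^sup>2) \<noteq> 0"
      using that by (auto simp: sum_nonneg_eq_0_iff fun_eq_iff)
    then show ?thesis
      by (simp add: order_less_le sum_nonneg)
  qed
  show ?thesis
    unfolding hess_quad_sq_norm_power
    using pos[OF assms(2)] pos[OF assms(3)] assms(1)
    by (intro add_pos_nonneg mult_pos_pos mult_nonneg_nonneg) auto
qed

section \<open>Positive semidefinite matrices are Gram matrices\<close>

text \<open>
  A Cholesky factorisation by induction on the size, splitting off the last index \<open>N\<close>. If the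
  corner entry is zero, positivity forces its whole row to vanish; otherwise the Schur
  complement of the corner is again positive semidefinite.
\<close>

lemma psd_imp_gram:
  assumes "psd N X"
  shows "\<exists>L :: nat \<Rightarrow> nat \<Rightarrow> real. \<forall>i<N. \<forall>j<N. X i j = (\<Sum>k<N. L k i * L k j)"
  using assms
proof (induction N arbitrary: X)
  case (Suc N)
  define x where "x = X N N"
  define b where "b v = (\<Sum>i<N. v i * X i N)" for v :: "nat \<Rightarrow> real"
  have sym: "X i j = X j i" if "i < Suc N" "j < Suc N" for i j
    using Suc.prems that by (auto simp: psd_def)
  have quad: "(\<Sum>i<N. \<Sum>j<N. v i * X i j * v j) + 2 * t * b v + t\<^sup>2 * x \<ge> 0" for v t
  proof -
    have "0 \<le> (\<Sum>i<Suc N. \<Sum>j<Suc N. (v(N := t)) i * X i j * (v(N := t)) j)"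
      using Suc.prems unfolding psd_def by blast
    also have "\<dots> = (\<Sum>i<N. \<Sum>j<N. v i * X i j * v j) + (\<Sum>i<N. v i * X i N * t)
        + (\<Sum>j<N. t * X N j * v j) + t * X N N * t"
      by (simp add: sum.distrib)
    also have "(\<Sum>i<N. v i * X i N * t) = t * b v"
      by (simp add: b_def sum_distrib_left mult_ac)
    also have "(\<Sum>j<N. t * X N j * v j) = t * b v"
      unfolding b_def sum_distrib_left using sym by (intro sum.cong refl) auto
    finally show ?thesis
      by (simp add: x_def power2_eq_square algebra_simps)
  qed
  have b_eq: "b (\<lambda>k. if k = i then 1 else 0) = X i N" if "i < N" for i
    using that by (simp add: b_def if_distrib[of "\<lambda>u. u * _"] cong: if_cong)
  have "x \<ge> 0"
    using quad[of "\<lambda>_. 0" 1] by (simp add: b_def)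
  show ?case
  proof (cases "x = 0")
    case True
    have b0: "b v = 0" for v
    proof (rule ccontr)
      assume "b v \<noteq> 0"
      let ?q = "\<Sum>i<N. \<Sum>j<N. v i * X i j * v j"
      show False
        \<comment> \<open>the form is now affine in \<open>t\<close> with slope \<open>2 b v \<noteq> 0\<close>; this \<open>t\<close> gives it the value \<open>-1\<close>\<close>
        using quad[of v "- (?q + 1) / (2 * b v)"] True \<open>b v \<noteq> 0\<close> by (simp add: field_simps)
    qed
    have "psd N X"
      using quad[of _ 0] sym by (simp add: psd_def)
    then obtain L where L: "\<forall>i<N. \<forall>j<N. X i j = (\<Sum>k<N. L k i * L k j)"
      using Suc.IH by blast
    have zero: "X i N = 0" "X N i = 0" if "i < N" for i
      using b_eq[OF that] b0 sym[of i N] that by auto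
    show ?thesis
      by (rule exI[of _ "\<lambda>k i. if k < N \<and> i < N then L k i else 0"])
         (use L zero True in \<open>auto simp: less_Suc_eq x_def\<close>)
  next
    case False
    with \<open>x \<ge> 0\<close> have "x > 0" by simp
    define Y where "Y i j = X i j - X i N * X j N / x" for i j
    have "psd N Y"
      unfolding psd_def
    proof (intro conjI allI impI)
      fix v :: "nat \<Rightarrow> real"
      have "(\<Sum>i<N. \<Sum>j<N. v i * Y i j * v j) =
          (\<Sum>i<N. \<Sum>j<N. v i * X i j * v j) - b v * b v / x"
        by (simp add: Y_def b_def sum_product sum_divide_distrib algebra_simps sum_subtractf)
      also have "\<dots> \<ge> 0"
        using quad[of v "- b v / x"] \<open>x > 0\<close> by (simp add: power2_eq_square field_simps)
      finally show "0 \<le> (\<Sum>i<N. \<Sum>j<N. v i * Y i j * v j)" .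
    qed (use sym in \<open>auto simp: Y_def\<close>)
    then obtain L where L: "\<forall>i<N. \<forall>j<N. Y i j = (\<Sum>k<N. L k i * L k j)"
      using Suc.IH by blast
    define L' where "L' k i = (if k < N then if i < N then L k i else 0 else X i N / sqrt x)" for k i
    have sq: "a / sqrt x * (c / sqrt x) = a * c / x" for a c
      using \<open>x > 0\<close> by simp
    have "X i j = (\<Sum>k<Suc N. L' k i * L' k j)" if ij: "i < Suc N" "j < Suc N" for i j
    proof (cases "i < N \<and> j < N")
      case True
      then have "(\<Sum>k<N. L' k i * L' k j) = Y i j"
        using L by (simp add: L'_def)
      then show ?thesis
        using True by (simp add: L'_def Y_def sq
          del: times_divide_eq_left times_divide_eq_right times_divide_times_eq)
    next
      case False
      then have "(\<Sum>k<N. L' k i * L' k j) = 0" and "i = N \<or> j = N"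
        using ij by (auto simp: L'_def)
      then show ?thesis
        using sym[OF ij] \<open>x > 0\<close> by (auto simp: L'_def sq x_def)
    qed
    then show ?thesis by blast
  qed
qed simp

lemma nonneg_quadratic_form_is_sum_of_squares:
  fixes A :: "'n::finite \<Rightarrow> 'n \<Rightarrow> real"
  assumes "\<And>v. (\<Sum>i\<in>UNIV. \<Sum>j\<in>UNIV. v i * A i j * v j) \<ge> 0"
  obtains N :: nat and L :: "nat \<Rightarrow> 'n \<Rightarrow> real" where
    "\<And>v. (\<Sum>i\<in>UNIV. \<Sum>j\<in>UNIV. v i * A i j * v j) = (\<Sum>k<N. (\<Sum>i\<in>UNIV. L k i * v i)\<^sup>2)"
proof -
  define N where "N = card (UNIV :: 'n set)"
  obtain h :: "nat \<Rightarrow> 'n" where h: "bij_betw h {..<N} UNIV"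
    using ex_bij_betw_nat_finite[of "UNIV :: 'n set"] by (auto simp: N_def lessThan_atLeast0)
  define X where "X i j = (A (h i) (h j) + A (h j) (h i)) / 2" for i j
  have reindex: "(\<Sum>i<N. g (h i)) = (\<Sum>i\<in>UNIV. g i)" for g :: "'n \<Rightarrow> real"
    by (rule sum.reindex_bij_betw[OF h])
  have reindex2: "(\<Sum>i<N. \<Sum>j<N. F (h i) (h j)) = (\<Sum>i\<in>UNIV. \<Sum>j\<in>UNIV. F i j)" for F :: "'n \<Rightarrow> 'n \<Rightarrow> real"
    unfolding reindex[of "F _"] by (rule reindex)
  have quad: "(\<Sum>i<N. \<Sum>j<N. v (h i) * X i j * v (h j)) = (\<Sum>i\<in>UNIV. \<Sum>j\<in>UNIV. v i * A i j * v j)"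
    for v :: "'n \<Rightarrow> real"
  proof -
    have "(\<Sum>i<N. \<Sum>j<N. v (h i) * X i j * v (h j)) =
        (\<Sum>i\<in>UNIV. \<Sum>j\<in>UNIV. v i * ((A i j + A j i) / 2) * v j)"
      unfolding X_def by (rule reindex2)
    also have "\<dots> = (\<Sum>i\<in>UNIV. \<Sum>j\<in>UNIV. v i * A i j * v j) / 2 +
        (\<Sum>i\<in>UNIV. \<Sum>j\<in>UNIV. v i * A j i * v j) / 2"
      by (simp add: sum_divide_distrib sum.distrib[symmetric] field_simps)
    also have "(\<Sum>i\<in>UNIV. \<Sum>j\<in>UNIV. v i * A j i * v j) = (\<Sum>i\<in>UNIV. \<Sum>j\<in>UNIV. v i * A i j * v j)"
      by (subst sum.swap) (simp add: mult_ac)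
    finally show ?thesis by simp
  qed
  have "psd N X"
    unfolding psd_def
  proof (intro conjI allI impI)
    fix v :: "nat \<Rightarrow> real"
    define w where "w i = v (inv_into {..<N} h i)" for i
    have "w (h i) = v i" if "i < N" for i
      using h that by (simp add: w_def bij_betw_def)
    then have "(\<Sum>i<N. \<Sum>j<N. v i * X i j * v j) = (\<Sum>i<N. \<Sum>j<N. w (h i) * X i j * w (h j))"
      by simp
    then show "0 \<le> (\<Sum>i<N. \<Sum>j<N. v i * X i j * v j)"
      using assms[of w] by (simp add: quad)
  qed (auto simp: X_def add.commute)
  then obtain L where L: "\<forall>i<N. \<forall>j<N. X i j = (\<Sum>k<N. L k i * L k j)"
    using psd_imp_gram by blast
  show ?thesis
  proof (rule that[where N = N and L = "\<lambda>k i. L k (inv_into {..<N} h i)"])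
    fix v :: "'n \<Rightarrow> real"
    have inv: "inv_into {..<N} h (h i) = i" if "i < N" for i
      using h that by (simp add: bij_betw_def)
    have "(\<Sum>i\<in>UNIV. \<Sum>j\<in>UNIV. v i * A i j * v j) =
        (\<Sum>i<N. \<Sum>j<N. \<Sum>k<N. (L k i * v (h i)) * (L k j * v (h j)))"
      unfolding quad[symmetric] by (intro sum.cong refl) (simp add: L sum_distrib_left mult_ac)
    also have "\<dots> = (\<Sum>k<N. \<Sum>i<N. \<Sum>j<N. (L k i * v (h i)) * (L k j * v (h j)))"
      by (subst sum.swap[of _ "{..<N}" "{..<N}"]) (subst (2) sum.swap, simp)
    also have "\<dots> = (\<Sum>k<N. (\<Sum>i<N. L k i * v (h i))\<^sup>2)"
      by (simp add: power2_eq_square sum_product)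
    also have "\<dots> = (\<Sum>k<N. (\<Sum>i\<in>UNIV. L k (inv_into {..<N} h i) * v i)\<^sup>2)"
      unfolding reindex[symmetric] by (intro sum.cong refl arg_cong[where f = "\<lambda>u. u\<^sup>2"]) (simp add: inv)
    finally show "(\<Sum>i\<in>UNIV. \<Sum>j\<in>UNIV. v i * A i j * v j) =
        (\<Sum>k<N. (\<Sum>i\<in>UNIV. L k (inv_into {..<N} h i) * v i)\<^sup>2)" .
  qed
qed

section \<open>Polya's theorem\<close>

text \<open>
  Forms of degree \<open>D\<close> in commuting variables \<open>y\<close> are written as tensors: one coefficient for each
  word of length \<open>D\<close> in the variables, without collecting equal monomials. This makes the two sides
  of Polya's theorem averages over lists of \<open>D\<close> positions in a long word: all lists of positions
  give the value of the form at the letter frequencies, and the lists without repetition give the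
  coefficients of the form multiplied by a power of the sum of the variables.
\<close>

definition words :: "'a set \<Rightarrow> nat \<Rightarrow> 'a list set" where
  "words A D = {u. set u \<subseteq> A \<and> length u = D}"

lemma finite_words: "finite A \<Longrightarrow> finite (words A D)"
  unfolding words_def by (rule finite_lists_length_eq)

lemma mem_words: "u \<in> words A D \<longleftrightarrow> set u \<subseteq> A \<and> length u = D"
  by (simp add: words_def)

lemma words_0 [simp]: "words A 0 = {[]}"
  by (auto simp: words_def)

lemma sum_words_Suc: "(\<Sum>u\<in>words A (Suc D). g u) = (\<Sum>k\<in>A. \<Sum>u\<in>words A D. g (k # u))"
proof -
  have eq: "words A (Suc D) = (\<lambda>(k, u). k # u) ` (A \<times> words A D)"
    by (auto simp: words_def length_Suc_conv image_iff)
  have "inj_on (\<lambda>(k, u). k # u) (A \<times> words A D)"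
    by (auto simp: inj_on_def)
  then show ?thesis
    unfolding eq by (simp add: sum.reindex sum.cartesian_product case_prod_unfold)
qed

definition word_form :: "nat \<Rightarrow> ('k::finite list \<Rightarrow> real) \<Rightarrow> ('k \<Rightarrow> real) \<Rightarrow> real" where
  "word_form D c y = (\<Sum>u\<in>words UNIV D. c u * prod_list (map y u))"

lemma word_form_0 [simp]: "word_form 0 c y = c []"
  by (simp add: word_form_def)

lemma word_form_Suc: "word_form (Suc D) c y = (\<Sum>k\<in>UNIV. y k * word_form D (\<lambda>u. c (k # u)) y)"
  by (simp add: word_form_def sum_words_Suc sum_distrib_left mult_ac)

lemma word_form_scale: "word_form D c (\<lambda>k. t * y k) = t ^ D * word_form D c y"
  by (induction D arbitrary: c) (simp_all add: word_form_Suc sum_distrib_left mult_ac)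

text \<open>
  Sampling \<open>D\<close> letters of \<open>w\<close> with replacement hits the word \<open>u\<close> as often as the product of the
  letter counts of \<open>u\<close> in \<open>w\<close>.
\<close>

lemma sum_word_samples:
  fixes w :: "nat \<Rightarrow> 'k::finite"
  shows "(\<Sum>\<iota>\<in>words {..<M} D. c (map w \<iota>)) = word_form D c (\<lambda>k. real (card {j\<in>{..<M}. w j = k}))"
proof (induction D arbitrary: c)
  case (Suc D)
  have "(\<Sum>\<iota>\<in>words {..<M} (Suc D). c (map w \<iota>)) =
      (\<Sum>j<M. word_form D (\<lambda>u. c (w j # u)) (\<lambda>k. real (card {j\<in>{..<M}. w j = k})))"
    unfolding sum_words_Suc list.map by (intro sum.cong refl) (rule Suc.IH)
  also have "\<dots> = word_form (Suc D) c (\<lambda>k. real (card {j\<in>{..<M}. w j = k}))"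
    unfolding word_form_Suc by (rule sum_fun_comp) auto
  finally show ?case .
qed simp

text \<open>
  Distribute \<open>(\<Sum>\<^sub>k y\<^sub>k)\<^sup>M\<^sup>-\<^sup>D\<close> times the form into words \<open>w\<close> of length \<open>M\<close>, placing the \<open>D\<close> letters of the
  form at the chosen positions \<open>\<iota>\<close>. Any choice of distinct positions gives an expansion of the same
  product, so these expansions may be averaged.
\<close>

lemma sum_words_through_positions:
  fixes y :: "'k::finite \<Rightarrow> real" and I :: "'i set"
  assumes "distinct \<iota>" "finite I" "set \<iota> \<subseteq> I"
  shows "(\<Sum>w\<in>Pi\<^sub>E I (\<lambda>_. UNIV). c (map w \<iota>) * (\<Prod>j\<in>I. y (w j))) =
    word_form (length \<iota>) c y * (\<Sum>k\<in>UNIV. y k) ^ (card I - length \<iota>)"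
  using assms
proof (induction \<iota> arbitrary: I c)
  case Nil
  have "(\<Sum>w\<in>Pi\<^sub>E I (\<lambda>_. UNIV). \<Prod>j\<in>I. y (w j)) = (\<Prod>j\<in>I. \<Sum>k\<in>UNIV. y k)"
    using Nil by (subst prod_sum_PiE) auto
  then show ?case
    by (simp add: sum_distrib_left[symmetric])
next
  case (Cons j \<iota>)
  define J where "J = I - {j}"
  have I: "I = insert j J" "j \<notin> J" "finite J" "set \<iota> \<subseteq> J" "card I = Suc (card J)"
    using Cons.prems card.remove[of I j] by (auto simp: J_def)
  have inj: "inj_on (\<lambda>(k, w). w(j := k)) (UNIV \<times> Pi\<^sub>E J (\<lambda>_. UNIV :: 'k set))"
    using I(2) by (rule inj_combinator)
  have "(\<Sum>w\<in>Pi\<^sub>E I (\<lambda>_. UNIV). c (map w (j # \<iota>)) * (\<Prod>j\<in>I. y (w j))) =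
      (\<Sum>k\<in>UNIV. \<Sum>w\<in>Pi\<^sub>E J (\<lambda>_. UNIV). c (map (w(j := k)) (j # \<iota>)) * (\<Prod>i\<in>I. y ((w(j := k)) i)))"
    unfolding I(1) PiE_insert_eq sum.reindex[OF inj]
    by (simp add: sum.cartesian_product case_prod_beta)
  also have "\<dots> = (\<Sum>k\<in>UNIV. y k * (\<Sum>w\<in>Pi\<^sub>E J (\<lambda>_. UNIV). c (k # map w \<iota>) * (\<Prod>i\<in>J. y (w i))))"
    unfolding sum_distrib_left
  proof (intro sum.cong refl)
    fix k and w :: "'i \<Rightarrow> 'k"
    have map: "map (w(j := k)) \<iota> = map w \<iota>"
      using I by (intro map_cong) auto
    have prod: "(\<Prod>i\<in>J. y ((w(j := k)) i)) = (\<Prod>i\<in>J. y (w i))"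
      using I by (intro prod.cong) auto
    show "c (map (w(j := k)) (j # \<iota>)) * (\<Prod>i\<in>I. y ((w(j := k)) i)) =
        y k * (c (k # map w \<iota>) * (\<Prod>i\<in>J. y (w i)))"
      unfolding I(1) prod.insert[OF I(3,2)] list.map map prod by simp
  qed
  also have "\<dots> = (\<Sum>k\<in>UNIV. y k * (word_form (length \<iota>) (\<lambda>u. c (k # u)) y *
      (\<Sum>k\<in>UNIV. y k) ^ (card J - length \<iota>)))"
    using Cons.prems I by (subst Cons.IH) auto
  also have "\<dots> = word_form (length (j # \<iota>)) c y * (\<Sum>k\<in>UNIV. y k) ^ (card I - length (j # \<iota>))"
    by (simp add: word_form_Suc sum_distrib_right I(5) mult.assoc)
  finally show ?case .
qed

definition injective_words :: "nat \<Rightarrow> nat \<Rightarrow> nat list set" where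
  "injective_words M D = {\<iota>. length \<iota> = D \<and> distinct \<iota> \<and> set \<iota> \<subseteq> {..<M}}"

lemma injective_words_subset: "injective_words M D \<subseteq> words {..<M} D"
  by (auto simp: injective_words_def words_def)

lemma finite_injective_words: "finite (injective_words M D)"
  by (rule finite_subset[OF injective_words_subset finite_words]) simp

lemma card_injective_words_ge:
  assumes "D \<le> M"
  shows "real (card (injective_words M D)) \<ge> (real M - real D) ^ D"
proof -
  have "(M - D) ^ D = (\<Prod>i\<in>{M - D + 1..M}. M - D)"
    using assms by simp
  also have "\<dots> \<le> \<Prod>{M - D + 1..M}"
    by (intro prod_mono) auto
  also have "\<dots> = card (injective_words M D)"
    unfolding injective_words_def using card_lists_distinct_length_eq[of "{..<M}" D] assms by simp
  finally have "real ((M - D) ^ D) \<le> real (card (injective_words M D))"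
    by (rule of_nat_mono)
  then show ?thesis
    using assms by (simp add: of_nat_diff)
qed

text \<open>
  Polya's theorem, for a family of forms with common bounds. The expansion averaged over all
  choices of distinct positions has as coefficient of \<open>w\<close> a sum of \<^term>\<open>c s (map w \<iota>)\<close>. Sampling
  without repetition differs from sampling with repetition in a fraction of all \<open>M\<^sup>D\<close> samples that
  tends to \<open>0\<close> as \<open>M\<close> grows, and sampling with repetition gives \<open>M\<^sup>D\<close> times the value of the form
  at a point of the simplex, which is at least \<open>\<epsilon>\<close>. The bound on \<open>M\<close> does not depend on \<open>s\<close>; this
  uniformity is what later yields positive semidefinite matrix coefficients.
\<close>

lemma polya_uniform:
  fixes c :: "'s \<Rightarrow> 'k::finite list \<Rightarrow> real"
  assumes bound: "\<And>s u. s \<in> S \<Longrightarrow> length u = D \<Longrightarrow> \<bar>c s u\<bar> \<le> C" and "\<epsilon> > 0"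
    and pos: "\<And>s y. s \<in> S \<Longrightarrow> (\<And>k. y k \<ge> 0) \<Longrightarrow> (\<Sum>k\<in>UNIV. y k) = 1 \<Longrightarrow> word_form D (c s) y \<ge> \<epsilon>"
  obtains M where "M > D" "\<And>s w. s \<in> S \<Longrightarrow> (\<Sum>\<iota>\<in>injective_words M D. c s (map w \<iota>)) \<ge> 0"
proof -
  have "(\<lambda>M. \<bar>C\<bar> * (1 - (1 - real D / real M) ^ D)) \<longlonglongrightarrow> \<bar>C\<bar> * (1 - (1 - 0) ^ D)"
    by (intro tendsto_intros tendsto_divide_0[OF tendsto_const] filterlim_real_sequentially
        filterlim_at_top_imp_at_infinity)
  then have "(\<lambda>M. \<bar>C\<bar> * (1 - (1 - real D / real M) ^ D)) \<longlonglongrightarrow> 0"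
    by simp
  then have "\<forall>\<^sub>F M in sequentially. \<bar>C\<bar> * (1 - (1 - real D / real M) ^ D) < \<epsilon>"
    using \<open>\<epsilon> > 0\<close> by (rule order_tendstoD)
  moreover have "\<forall>\<^sub>F M in sequentially. M > D"
    by (rule eventually_gt_at_top)
  ultimately have "\<forall>\<^sub>F M in sequentially. \<bar>C\<bar> * (1 - (1 - real D / real M) ^ D) < \<epsilon> \<and> M > D"
    by eventually_elim auto
  then obtain M where M: "\<bar>C\<bar> * (1 - (1 - real D / real M) ^ D) < \<epsilon>" "M > D"
    by (auto dest: eventually_happens)
  have "M > 0" using M by simp
  show ?thesis
  proof (rule that[OF M(2)])
    fix s and w :: "nat \<Rightarrow> 'k" assume s: "s \<in> S"
    let ?A = "words {..<M} D" and ?J = "injective_words M D"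
    let ?n = "\<lambda>k. real (card {j\<in>{..<M}. w j = k})"
    have fin: "finite ?A" by (simp add: finite_words)
    have cA: "real (card ?A) = real M ^ D"
      by (simp add: words_def card_lists_length_eq)
    have "(\<Sum>k\<in>UNIV. ?n k / real M) = 1"
    proof -
      have "(\<Sum>k\<in>UNIV. ?n k) = (\<Sum>j<M. 1)"
        using sum_fun_comp[of "{..<M}" "UNIV :: 'k set" w "\<lambda>_. 1::real"]
        by (simp only: finite finite_lessThan subset_UNIV mult_1_right simp_thms)
      then show ?thesis
        using \<open>M > 0\<close> by (simp add: sum_divide_distrib[symmetric])
    qed
    then have "\<epsilon> \<le> word_form D (c s) (\<lambda>k. ?n k / real M)"
      using s by (intro pos) auto
    then have "real M ^ D * \<epsilon> \<le> real M ^ D * word_form D (c s) (\<lambda>k. ?n k / real M)"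
      by (intro mult_left_mono) auto
    also have "\<dots> = (\<Sum>\<iota>\<in>?A. c s (map w \<iota>))"
      using \<open>M > 0\<close> by (simp add: word_form_scale[symmetric] sum_word_samples)
    also have "\<dots> = (\<Sum>\<iota>\<in>?J. c s (map w \<iota>)) + (\<Sum>\<iota>\<in>?A - ?J. c s (map w \<iota>))"
      using sum.subset_diff[OF injective_words_subset fin] by (simp add: add.commute)
    finally have 1: "real M ^ D * \<epsilon> \<le> (\<Sum>\<iota>\<in>?J. c s (map w \<iota>)) + (\<Sum>\<iota>\<in>?A - ?J. c s (map w \<iota>))" .
    have "(\<Sum>\<iota>\<in>?A - ?J. c s (map w \<iota>)) \<le> real (card (?A - ?J)) * \<bar>C\<bar>"
    proof (rule sum_bounded_above)
      fix \<iota> assume "\<iota> \<in> ?A - ?J"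
      then have "length (map w \<iota>) = D"
        by (simp add: words_def)
      from bound[OF s this] show "c s (map w \<iota>) \<le> \<bar>C\<bar>"
        by linarith
    qed
    also have "real (card (?A - ?J)) = real M ^ D - real (card ?J)"
      using card_mono[OF fin injective_words_subset] cA
      by (simp add: card_Diff_subset injective_words_subset finite_injective_words of_nat_diff)
    also have "\<dots> * \<bar>C\<bar> \<le> (real M ^ D - (real M - real D) ^ D) * \<bar>C\<bar>"
      using card_injective_words_ge[of D M] M(2) by (intro mult_right_mono) auto
    also have "\<dots> = real M ^ D * (\<bar>C\<bar> * (1 - (1 - real D / real M) ^ D))"
    proof -
      have "(real M - real D) ^ D = real M ^ D * (1 - real D / real M) ^ D"
        using \<open>M > 0\<close> by (simp add: power_mult_distrib[symmetric] right_diff_distrib)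
      then show ?thesis by (simp add: algebra_simps)
    qed
    also have "\<dots> \<le> real M ^ D * \<epsilon>"
      using M(1) by (intro mult_left_mono) auto
    finally show "(\<Sum>\<iota>\<in>?J. c s (map w \<iota>)) \<ge> 0"
      using 1 by simp
  qed
qed

section \<open>Positive definite matrices of forms\<close>

text \<open>
  The functions given by forms of degree \<open>D\<close>. They are handled as functions because only
  existence of coefficients matters, and the closure properties below provide it.
\<close>

definition word_forms :: "nat \<Rightarrow> (('k::finite \<Rightarrow> real) \<Rightarrow> real) set" where
  "word_forms D = range (word_form D)"

lemma word_formsI: "(\<And>y. h y = word_form D c y) \<Longrightarrow> h \<in> word_forms D"
  by (auto simp: word_forms_def)

lemma word_form_add: "word_form D (\<lambda>u. c u + d u) y = word_form D c y + word_form D d y"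
  by (simp add: word_form_def algebra_simps sum.distrib)

lemma word_form_cmult: "word_form D (\<lambda>u. a * c u) y = a * word_form D c y"
  by (simp add: word_form_def sum_distrib_left mult_ac)

lemma word_form_sum: "word_form D (\<lambda>u. \<Sum>s\<in>S. c s u) y = (\<Sum>s\<in>S. word_form D (c s) y)"
  unfolding word_form_def sum_distrib_right by (rule sum.swap)

lemma word_forms_const: "(\<lambda>_. a) \<in> word_forms 0"
  by (rule word_formsI[where c = "\<lambda>_. a"]) simp

lemma word_forms_add: "g \<in> word_forms D \<Longrightarrow> h \<in> word_forms D \<Longrightarrow> (\<lambda>y. g y + h y) \<in> word_forms D"
  unfolding word_forms_def by (auto simp: fun_eq_iff image_iff word_form_add[symmetric])

lemma word_forms_cmult: "h \<in> word_forms D \<Longrightarrow> (\<lambda>y. a * h y) \<in> word_forms D"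
  unfolding word_forms_def by (auto simp: fun_eq_iff image_iff word_form_cmult[symmetric])

lemma word_forms_zero: "(\<lambda>_. 0) \<in> word_forms D"
  by (rule word_formsI[where c = "\<lambda>_. 0"]) (simp add: word_form_def)

lemma word_forms_sum:
  "(\<And>s. s \<in> S \<Longrightarrow> h s \<in> word_forms D) \<Longrightarrow> (\<lambda>y. \<Sum>s\<in>S. h s y) \<in> word_forms D"
  by (induction S rule: infinite_finite_induct) (auto intro: word_forms_zero word_forms_add)

lemma word_forms_coord_mult:
  assumes "h \<in> word_forms D"
  shows "(\<lambda>y. y k * h y) \<in> word_forms (Suc D)"
proof -
  obtain c where c: "h = word_form D c"
    using assms by (auto simp: word_forms_def)
  have "y k * h y = word_form (Suc D) (\<lambda>u. (if hd u = k then 1 else 0) * c (tl u)) y" for y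
  proof -
    have "y l * ((if l = k then 1 else 0) * a) = (if l = k then y l * a else 0)" for l a
      by simp
    then show ?thesis
      by (simp only: word_form_Suc word_form_cmult c list.sel) simp
  qed
  then show ?thesis
    by (rule word_formsI)
qed

lemma word_forms_mult:
  assumes "g \<in> word_forms a" "h \<in> word_forms b"
  shows "(\<lambda>y. g y * h y) \<in> word_forms (a + b)"
  using assms(1)
proof (induction a arbitrary: g)
  case 0
  then show ?case
    using word_forms_cmult[OF assms(2)] by (auto simp: word_forms_def)
next
  case (Suc a)
  then obtain c where c: "g = word_form (Suc a) c"
    by (auto simp: word_forms_def)
  have "(\<lambda>y. y k * (word_form a (\<lambda>u. c (k # u)) y * h y)) \<in> word_forms (Suc (a + b))" for k
    by (rule word_forms_coord_mult) (rule Suc.IH, simp add: word_forms_def)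
  then have "(\<lambda>y. \<Sum>k\<in>UNIV. y k * (word_form a (\<lambda>u. c (k # u)) y * h y)) \<in> word_forms (Suc (a + b))"
    by (intro word_forms_sum)
  then show ?case
    by (simp add: c word_form_Suc sum_distrib_right mult.assoc)
qed

lemma word_forms_coord: "(\<lambda>y. y k) \<in> word_forms 1"
  using word_forms_coord_mult[OF word_forms_const[of 1], of k] by simp

lemma word_forms_total: "(\<lambda>y. \<Sum>k\<in>UNIV. y k) \<in> word_forms 1"
  by (intro word_forms_sum word_forms_coord)

lemma word_forms_power: "h \<in> word_forms a \<Longrightarrow> (\<lambda>y. h y ^ n) \<in> word_forms (n * a)"
  by (induction n) (auto intro: word_forms_const word_forms_mult)

lemma continuous_on_word_form [continuous_intros]:
  assumes "\<And>k. continuous_on S (\<lambda>s. y s k)"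
  shows "continuous_on S (\<lambda>s. word_form D c (y s))"
  by (induction D arbitrary: c) (auto simp: word_form_Suc intro!: continuous_intros assms)

text \<open>
  The squares \<open>(x\<^sub>i + x\<^sub>j)\<^sup>2\<close> and \<open>(x\<^sub>i - x\<^sub>j)\<^sup>2\<close>, for all ordered pairs, serve as new variables \<open>y\<close>. Every
  monomial in them is the square of a polynomial, they span all products \<open>x\<^sub>i x\<^sub>j\<close>
  by polarisation, and their sum is a multiple of \<open>|x|\<^sup>2\<close>. The pairs
  with \<open>i = j\<close> contribute the squares \<open>4x\<^sub>i\<^sup>2\<close> of the variables.
\<close>

definition sq_coord :: "('n \<Rightarrow> real) \<Rightarrow> 'n \<times> 'n \<times> bool \<Rightarrow> real" where
  "sq_coord x = (\<lambda>(i, j, b). (x i + (if b then x j else - x j))\<^sup>2)"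

definition polar :: "('n \<times> 'n \<times> bool \<Rightarrow> real) \<Rightarrow> 'n \<Rightarrow> 'n \<Rightarrow> real" where
  "polar y i j = (y (i, j, True) - y (i, j, False)) / 4"

lemma polar_sq_coord [simp]: "polar (sq_coord x) i j = x i * x j"
  by (simp add: polar_def sq_coord_def power2_eq_square algebra_simps)

lemma word_forms_polar: "(\<lambda>y. polar y i j) \<in> word_forms 1"
proof -
  have "(\<lambda>y. (1/4) * y (i, j, True) + (- (1/4)) * y (i, j, False)) \<in> word_forms 1"
    by (intro word_forms_add word_forms_cmult word_forms_coord)
  then show ?thesis
    by (simp add: polar_def algebra_simps diff_divide_distrib)
qed

text \<open>
  The equations satisfied by the image of \<^const>\<open>sq_coord\<close>: each \<open>y\<close> is determined by the matrix
  \<open>X = polar y\<close>, and \<open>X = x x\<^sup>T\<close> has vanishing minors through a diagonal entry.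
\<close>

definition linear_defect :: "('n \<times> 'n \<times> bool \<Rightarrow> real) \<Rightarrow> 'n \<times> 'n \<times> bool \<Rightarrow> real" where
  "linear_defect y = (\<lambda>(i, j, b). y (i, j, b) -
     (polar y i i + polar y j j + (if b then 2 else - 2) * polar y i j))"

definition rank_defect :: "('n \<times> 'n \<times> bool \<Rightarrow> real) \<Rightarrow> 'n \<times> 'n \<times> 'n \<Rightarrow> real" where
  "rank_defect y = (\<lambda>(p, j, k). polar y p j * polar y p k - polar y p p * polar y j k)"

text \<open>
  The powers of the sum of the variables bring both kinds of squares, of degrees \<open>2\<close> and \<open>4\<close>, to the
  common degree \<open>\<delta> + 4\<close>; on the simplex they equal \<open>1\<close>.
\<close>

definition penalty :: "nat \<Rightarrow> ('n::finite \<times> 'n \<times> bool \<Rightarrow> real) \<Rightarrow> real" where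
  "penalty \<delta> y = (\<Sum>t\<in>UNIV. (linear_defect y t)\<^sup>2) * (\<Sum>k\<in>UNIV. y k) ^ (\<delta> + 2) +
     (\<Sum>t\<in>UNIV. (rank_defect y t)\<^sup>2) * (\<Sum>k\<in>UNIV. y k) ^ \<delta>"

lemma word_forms_total_power: "(\<lambda>y. (\<Sum>k\<in>UNIV. y k) ^ n) \<in> word_forms n"
  using word_forms_power[OF word_forms_total, of n] by simp

lemma word_forms_penalty:
  "(penalty \<delta> :: ('n::finite \<times> 'n \<times> bool \<Rightarrow> real) \<Rightarrow> real) \<in> word_forms (\<delta> + 4)"
proof -
  have lin: "(\<lambda>y. linear_defect y t) \<in> word_forms 1" for t :: "'n \<times> 'n \<times> bool"
  proof -
    obtain i j b where t: "t = (i, j, b)" by (cases t)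
    have "(\<lambda>y. y (i, j, b) + (- 1) * ((polar y i i + polar y j j) +
        (if b then 2 else - 2) * polar y i j)) \<in> word_forms 1"
      by (intro word_forms_add word_forms_cmult word_forms_coord word_forms_polar)
    then show ?thesis
      by (simp add: t linear_defect_def algebra_simps)
  qed
  have rank: "(\<lambda>y. rank_defect y t) \<in> word_forms 2" for t :: "'n \<times> 'n \<times> 'n"
  proof -
    obtain p j k where t: "t = (p, j, k)" by (cases t)
    have "(\<lambda>y. polar y p j * polar y p k + (- 1) * (polar y p p * polar y j k)) \<in> word_forms (1 + 1)"
      by (intro word_forms_add word_forms_cmult word_forms_mult word_forms_polar)
    then show ?thesis
      by (simp add: t rank_defect_def numeral_2_eq_2)
  qed
  have "(\<lambda>y. (linear_defect y t)\<^sup>2) \<in> word_forms 2" for t :: "'n \<times> 'n \<times> bool"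
    using word_forms_power[OF lin[of t], of 2] by simp
  then have 1: "(\<lambda>y :: 'n \<times> 'n \<times> bool \<Rightarrow> real. (\<Sum>t\<in>UNIV. (linear_defect y t)\<^sup>2) *
      (\<Sum>k\<in>UNIV. y k) ^ (\<delta> + 2)) \<in> word_forms (2 + (\<delta> + 2))"
    by (intro word_forms_mult word_forms_sum word_forms_total_power)
  have "(\<lambda>y. (rank_defect y t)\<^sup>2) \<in> word_forms 4" for t :: "'n \<times> 'n \<times> 'n"
    using word_forms_power[OF rank[of t], of 2] by simp
  then have 2: "(\<lambda>y :: 'n \<times> 'n \<times> bool \<Rightarrow> real. (\<Sum>t\<in>UNIV. (rank_defect y t)\<^sup>2) *
      (\<Sum>k\<in>UNIV. y k) ^ \<delta>) \<in> word_forms (4 + \<delta>)"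
    by (intro word_forms_mult word_forms_sum word_forms_total_power)
  have e: "2 + (\<delta> + 2) = \<delta> + 4" "4 + \<delta> = \<delta> + 4"
    by simp_all
  show ?thesis
    using word_forms_add[OF 1[unfolded e(1)] 2[unfolded e(2)]]
    by (simp add: penalty_def[abs_def])
qed

lemma penalty_sq_coord [simp]: "penalty \<delta> (sq_coord x) = 0"
proof -
  have "linear_defect (sq_coord x) t = 0" for t
  proof -
    obtain i j b where t: "t = (i, j, b)" by (cases t)
    show ?thesis
      unfolding linear_defect_def t prod.case polar_sq_coord
      by (simp add: sq_coord_def power2_eq_square algebra_simps)
  qed
  moreover have "rank_defect (sq_coord x) t = 0" for t
    by (cases t) (simp add: rank_defect_def)
  ultimately show ?thesis
    by (simp add: penalty_def)
qed

lemma sum_sign_triples: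
  "(\<Sum>k\<in>UNIV. y k) = (\<Sum>i\<in>UNIV. \<Sum>j\<in>UNIV. y (i, j, True) + y (i, j, False))"
  for y :: "'n::finite \<times> 'n \<times> bool \<Rightarrow> real"
proof -
  have "(\<Sum>k\<in>UNIV. y k) = (\<Sum>i\<in>UNIV. \<Sum>j\<in>UNIV. \<Sum>b\<in>UNIV. y (i, j, b))"
    by (simp add: sum.cartesian_product UNIV_Times_UNIV)
  then show ?thesis
    by (simp add: UNIV_bool add.commute)
qed

lemma sum_sq_coord:
  "(\<Sum>k\<in>UNIV. sq_coord x k) = 4 * real CARD('n) * (\<Sum>i\<in>UNIV. (x i)\<^sup>2)" for x :: "'n::finite \<Rightarrow> real"
proof -
  have "sq_coord x (i, j, True) + sq_coord x (i, j, False) = 2 * (x i)\<^sup>2 + 2 * (x j)\<^sup>2" for i j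
    by (simp add: sq_coord_def power2_eq_square algebra_simps)
  then show ?thesis
    by (simp add: sum_sign_triples sum.distrib sum_distrib_left[symmetric])
qed

text \<open>
  Conversely, the penalty vanishes on the simplex only at points of the image. The linear
  equations make the diagonal of \<open>X = polar y\<close> nonnegative and not all zero; if \<open>X\<^sub>p\<^sub>p > 0\<close>, the minors
  give \<open>X = x x\<^sup>T\<close> for the \<open>p\<close>-th row divided by \<open>\<surd>X\<^sub>p\<^sub>p\<close>.
\<close>

lemma penalty_zero_imp_sq_coord:
  fixes y :: "'n::finite \<times> 'n \<times> bool \<Rightarrow> real"
  assumes nonneg: "\<And>k. y k \<ge> 0" and total: "(\<Sum>k\<in>UNIV. y k) = 1" and pen: "penalty \<delta> y = 0"
  obtains x where "x \<noteq> (\<lambda>_. 0)" "y = sq_coord x"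
proof -
  have "linear_defect y t = 0" and "rank_defect y s = 0" for t s
    using pen by (auto simp only: penalty_def total power_one mult_1_right add_nonneg_eq_0_iff
        sum_nonneg sum_nonneg_eq_0_iff finite zero_le_power2 power2_eq_iff_nonneg UNIV_I power_eq_0_iff
        ball_UNIV)
  then have lin: "y (i, j, b) = polar y i i + polar y j j + (if b then 2 else - 2) * polar y i j"
    and rank: "polar y p j * polar y p k = polar y p p * polar y j k" for i j b p k
    by (auto simp: linear_defect_def rank_defect_def) (metis case_prod_conv eq_iff_diff_eq_0)+
  have diag: "polar y i i \<ge> 0" for i
    using nonneg[of "(i, i, True)"] lin[of i i True] by simp
  have "\<exists>p. polar y p p \<noteq> 0"
  proof (rule ccontr)
    assume "\<nexists>p. polar y p p \<noteq> 0"
    then have "y (i, j, True) + y (i, j, False) = 0" for i j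
      by (simp add: lin)
    then show False
      using total by (simp add: sum_sign_triples)
  qed
  then obtain p where p: "polar y p p > 0"
    using diag by (metis order_less_le)
  define x where "x j = polar y p j / sqrt (polar y p p)" for j
  have prod: "x j * x k = polar y j k" for j k
    using p rank[of p j k] by (simp add: x_def field_simps)
  show ?thesis
  proof (rule that)
    show "x \<noteq> (\<lambda>_. 0)"
      using p prod[of p p] by auto
    show "y = sq_coord x"
      by (auto simp: fun_eq_iff lin sq_coord_def prod[symmetric] power2_eq_square algebra_simps)
  qed
qed

text \<open>
  Grouping the variables of a monomial of even degree in pairs and polarising each pair turns a form
  of degree \<open>2\<delta>\<close> in \<open>x\<close> into a form of degree \<open>\<delta>\<close> in the squares.
\<close>

lemma even_form_is_word_form_in_sq_coord:
  fixes p :: "'n::finite rpoly"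
  assumes "is_form (2 * \<delta>) p"
  obtains c where "\<And>x. word_form \<delta> c (sq_coord x) = eval_poly x p"
proof -
  have mono: "\<exists>h\<in>word_forms \<delta>. \<forall>x. h (sq_coord x) = eval_poly x (Poly_Mapping.single m 1)"
    if "mdeg m = 2 * \<delta>" for m :: "'n monomial" and \<delta>
    using that
  proof (induction \<delta> arbitrary: m)
    case 0
    then have "m = 0" by (simp add: mdeg_zero_iff)
    then show ?case
      by (intro bexI[OF _ word_forms_const[of 1]]) simp
  next
    case (Suc \<delta>)
    then have "mdeg m = Suc (Suc (2 * \<delta>))" by simp
    then obtain i m1 where 1: "m = m1 + Poly_Mapping.single i 1" "mdeg m1 = Suc (2 * \<delta>)"
      by (rule mdeg_pos_split)
    then obtain j m2 where 2: "m1 = m2 + Poly_Mapping.single j 1" "mdeg m2 = 2 * \<delta>"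
      by (elim mdeg_pos_split)
    have "Poly_Mapping.single m 1 = Var i * Var j * (Poly_Mapping.single m2 1 :: 'n rpoly)"
      by (simp add: 1 2 Var_def mult_single add_ac)
    moreover obtain h where "h \<in> word_forms \<delta>" "\<forall>x. h (sq_coord x) = eval_poly x (Poly_Mapping.single m2 1)"
      using Suc.IH[OF 2(2)] by blast
    ultimately show ?case
      using word_forms_mult[OF word_forms_polar[of i j], of h \<delta>]
      by (intro bexI[of _ "\<lambda>y. polar y i j * h y"]) (auto simp: eval_poly_mult simp del: eval_poly_single)
  qed
  have "\<forall>m\<in>Poly_Mapping.keys p. \<exists>h. h \<in> word_forms \<delta> \<and>
      (\<forall>x. h (sq_coord x) = eval_poly x (Poly_Mapping.single m 1))"
    using mono assms unfolding is_form_def by blast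
  then obtain h where h: "h m \<in> word_forms \<delta> \<and>
      (\<forall>x. h m (sq_coord x) = eval_poly x (Poly_Mapping.single m 1))" if "m \<in> Poly_Mapping.keys p" for m
    by (auto dest!: bchoice simp del: eval_poly_single)
  have "(\<lambda>y. \<Sum>m\<in>Poly_Mapping.keys p. Poly_Mapping.lookup p m * h m y) \<in> word_forms \<delta>"
    using h by (intro word_forms_sum word_forms_cmult) auto
  then obtain c where c: "\<And>y. (\<Sum>m\<in>Poly_Mapping.keys p. Poly_Mapping.lookup p m * h m y) = word_form \<delta> c y"
    by (auto simp: word_forms_def fun_eq_iff)
  show ?thesis
  proof (rule that[of c])
    fix x
    have "word_form \<delta> c (sq_coord x) = (\<Sum>m\<in>Poly_Mapping.keys p. Poly_Mapping.lookup p m *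
        eval_poly x (Poly_Mapping.single m 1))"
      unfolding c[symmetric] using h by (intro sum.cong refl) auto
    also have "\<dots> = eval_poly x p"
      unfolding eval_poly_single by (simp add: eval_poly_def subst_poly_def)
    finally show "word_form \<delta> c (sq_coord x) = eval_poly x p" .
  qed
qed

text \<open>
  On the compact set where \<open>p \<le> 0\<close>, the function \<open>q\<close> has a positive minimum, so a large multiple of
  \<open>q\<close> compensates the most negative value of \<open>p\<close>.
\<close>

lemma compact_penalty:
  fixes p q :: "'a::topological_space \<Rightarrow> real"
  assumes "compact S" "continuous_on S p" "continuous_on S q"
    and "\<And>s. s \<in> S \<Longrightarrow> q s \<ge> 0" and "\<And>s. s \<in> S \<Longrightarrow> q s = 0 \<Longrightarrow> p s > 0"
  obtains C \<epsilon> where "\<epsilon> > 0" "\<And>s. s \<in> S \<Longrightarrow> p s + C * q s \<ge> \<epsilon>"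
proof -
  have "\<exists>C. \<forall>s\<in>S. p s + C * q s > 0"
  proof (cases "\<exists>s\<in>S. p s \<le> 0")
    case False
    then show ?thesis by (intro exI[of _ 0]) auto
  next
    case True
    define T where "T = S \<inter> p -` {..0}"
    have "compact T"
      unfolding T_def
      by (rule closedin_compact[OF assms(1) continuous_closedin_preimage[OF assms(2) closed_atMost]])
    moreover have "T \<noteq> {}" and sub: "T \<subseteq> S"
      using True by (auto simp: T_def)
    ultimately have "\<exists>t\<in>T. \<forall>s\<in>T. q t \<le> q s" "\<exists>u\<in>T. \<forall>s\<in>T. p u \<le> p s"
      using continuous_on_subset[OF assms(2) sub] continuous_on_subset[OF assms(3) sub]
      by (auto intro!: continuous_attains_inf)
    then obtain t u where t: "t \<in> T" "\<And>s. s \<in> T \<Longrightarrow> q t \<le> q s"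
      and u: "u \<in> T" "\<And>s. s \<in> T \<Longrightarrow> p u \<le> p s"
      by blast
    have "q t > 0"
      using assms(4,5)[of t] t(1) by (force simp: T_def)
    have "p s + (\<bar>p u\<bar> + 1) / q t * q s > 0" if "s \<in> S" for s
    proof (cases "s \<in> T")
      case True
      have "(\<bar>p u\<bar> + 1) / q t * q s \<ge> (\<bar>p u\<bar> + 1) / q t * q t"
        using t(2)[OF True] \<open>q t > 0\<close> by (intro mult_left_mono) auto
      then show ?thesis
        using u(2)[OF True] \<open>q t > 0\<close> by simp
    next
      case False
      then have "p s > 0"
        using that by (auto simp: T_def)
      then show ?thesis
        using assms(4)[OF that] \<open>q t > 0\<close> by (intro add_pos_nonneg) auto
    qed
    then show ?thesis by blast
  qed
  then obtain C where C: "\<And>s. s \<in> S \<Longrightarrow> p s + C * q s > 0" by blast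
  show ?thesis
  proof (cases "S = {}")
    case True
    then show ?thesis by (intro that[of 1]) auto
  next
    case False
    have "continuous_on S (\<lambda>s. p s + C * q s)"
      by (intro continuous_intros assms(2,3))
    then obtain m where "m \<in> S" "\<And>s. s \<in> S \<Longrightarrow> p m + C * q m \<le> p s + C * q s"
      using continuous_attains_inf[OF assms(1) False] by blast
    then show ?thesis
      using C by (intro that[of "p m + C * q m" C]) auto
  qed
qed

text \<open>
  The matrix version of Reznick's theorem, deduced from Polya's. Rewrite the entries in the variables \<open>y = sq_coord x\<close>. The resulting matrix form in \<open>y\<close> is known
  to be positive definite only on the image of \<^const>\<open>sq_coord\<close> outside \<open>0\<close>, but adding a large
  multiple of the penalty times the identity matrix makes it so on the whole simplex, without changing its values
  on the image. Polya's theorem, applied simultaneously to the quadratic forms of all unit vectors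
  \<open>v\<close>, makes all coefficients of a multiple by a power of \<open>\<Sum>\<^sub>k y\<^sub>k\<close> positive semidefinite. Substituting
  back, \<open>\<Sum>\<^sub>k y\<^sub>k\<close> becomes a multiple of \<open>|x|\<^sup>2\<close> and monomials in \<open>y\<close> become squares.
\<close>

lemma positive_matrix_form_times_norm_power:
  fixes F :: "'m::finite \<Rightarrow> 'm \<Rightarrow> 'n::finite rpoly"
  assumes form: "\<And>i j. is_form (2 * \<delta>) (F i j)"
    and pos: "\<And>x v. x \<noteq> (\<lambda>_. 0) \<Longrightarrow> v \<noteq> (\<lambda>_. 0) \<Longrightarrow>
      (\<Sum>i\<in>UNIV. \<Sum>j\<in>UNIV. v i * eval_poly x (F i j) * v j) > 0"
  obtains r :: nat and W :: "(nat \<Rightarrow> 'n \<times> 'n \<times> bool) set" and q :: "_ \<Rightarrow> 'n rpoly"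
    and A :: "_ \<Rightarrow> 'm \<Rightarrow> 'm \<Rightarrow> real"
  where "finite W" "\<And>w v. (\<Sum>i\<in>UNIV. \<Sum>j\<in>UNIV. v i * A w i j * v j) \<ge> 0"
    "\<And>x i j. (\<Sum>k\<in>UNIV. (x k)\<^sup>2) ^ r * eval_poly x (F i j) = (\<Sum>w\<in>W. A w i j * (eval_poly x (q w))\<^sup>2)"
proof -
  have "\<exists>c. \<forall>x. word_form \<delta> c (sq_coord x) = eval_poly x (F i j)" for i j
    by (rule even_form_is_word_form_in_sq_coord[OF form]) blast
  then obtain c where c: "\<And>i j x. word_form \<delta> (c i j) (sq_coord x) = eval_poly x (F i j)"
    by metis
  define P where "P y v = (\<Sum>i\<in>UNIV. \<Sum>j\<in>UNIV. v i * word_form \<delta> (c i j) y * v j)"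
    for y :: "'n \<times> 'n \<times> bool \<Rightarrow> real" and v
  define S where "S = {y :: real ^ ('n \<times> 'n \<times> bool). (\<forall>k. 0 \<le> y $ k) \<and> (\<Sum>k\<in>UNIV. y $ k) = 1} \<times>
      {v :: real ^ 'm. (\<Sum>i\<in>UNIV. (v $ i)\<^sup>2) = 1}"
  have "compact S"
    unfolding S_def
  proof (rule compact_Times)
    show "compact {y :: real ^ ('n \<times> 'n \<times> bool). (\<forall>k. 0 \<le> y $ k) \<and> (\<Sum>k\<in>UNIV. y $ k) = 1}"
      (is "compact ?Y")
    proof -
      have "closed ?Y"
        by (intro closed_Collect_conj closed_Collect_all closed_Collect_le closed_Collect_eq continuous_intros)
      moreover have "?Y \<subseteq> cbox 0 1"
      proof
        fix y assume y: "y \<in> ?Y"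
        have "y $ k \<le> 1" for k
          using member_le_sum[of k UNIV "($) y"] y by auto
        then show "y \<in> cbox 0 1"
          using y by (simp add: mem_box_cart)
      qed
      ultimately show ?thesis
        using bounded_subset[OF bounded_cbox] by (auto simp: compact_eq_bounded_closed)
    qed
    have "{v :: real ^ 'm. (\<Sum>i\<in>UNIV. (v $ i)\<^sup>2) = 1} = sphere 0 1"
      by (auto simp: norm_vec_def L2_set_def)
    then show "compact {v :: real ^ 'm. (\<Sum>i\<in>UNIV. (v $ i)\<^sup>2) = 1}"
      by simp
  qed
  obtain C \<epsilon> where "\<epsilon> > 0" and C:
    "\<And>s. s \<in> S \<Longrightarrow> P (($) (fst s)) (($) (snd s)) + C * penalty \<delta> (($) (fst s)) \<ge> \<epsilon>"
  proof (rule compact_penalty[OF \<open>compact S\<close>,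
      of "\<lambda>s. P (($) (fst s)) (($) (snd s))" "\<lambda>s. penalty \<delta> (($) (fst s))"])
    show "continuous_on S (\<lambda>s. P (($) (fst s)) (($) (snd s)))"
      unfolding P_def by (intro continuous_intros)
    obtain p where p: "penalty \<delta> = word_form (\<delta> + 4) (p :: ('n \<times> 'n \<times> bool) list \<Rightarrow> real)"
      using word_forms_penalty[of \<delta>, where ?'n = 'n] by (auto simp: word_forms_def)
    show "continuous_on S (\<lambda>s. penalty \<delta> (($) (fst s)))"
      unfolding p by (intro continuous_intros)
  next
    fix s assume "s \<in> S"
    then obtain y v where s: "s = (y, v)" and y: "\<And>k. y $ k \<ge> 0" "(\<Sum>k\<in>UNIV. y $ k) = 1"
      and v: "(\<Sum>i\<in>UNIV. (v $ i)\<^sup>2) = 1"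
      by (auto simp: S_def)
    show "penalty \<delta> (($) (fst s)) \<ge> 0"
      by (simp add: s penalty_def y sum_nonneg)
    assume "penalty \<delta> (($) (fst s)) = 0"
    then obtain x where x: "x \<noteq> (\<lambda>_. 0)" "($) y = sq_coord x"
      using penalty_zero_imp_sq_coord[of "($) y" \<delta>] y s by auto
    have "($) v \<noteq> (\<lambda>_. 0)"
    proof
      assume "($) v = (\<lambda>_. 0)"
      with v show False by simp
    qed
    then show "P (($) (fst s)) (($) (snd s)) > 0"
      using pos[OF x(1)] by (simp add: s P_def x(2) c)
  qed (rule that)
  \<comment> \<open>the factor \<open>\<sigma>\<^sup>4\<close>, equal to \<open>1\<close> on the simplex, brings the entries to the degree of the penalty\<close>
  define D where "D = \<delta> + 4"
  define \<sigma> where "\<sigma> y = (\<Sum>k\<in>UNIV. y k)" for y :: "'n \<times> 'n \<times> bool \<Rightarrow> real"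
  define H where "H i j y = word_form \<delta> (c i j) y * \<sigma> y ^ 4 + (if i = j then C else 0) * penalty \<delta> y"
    for i j :: 'm and y :: "'n \<times> 'n \<times> bool \<Rightarrow> real"
  have "H i j \<in> word_forms D" for i j
    unfolding H_def[abs_def] D_def \<sigma>_def
    by (intro word_forms_add word_forms_mult word_forms_cmult word_forms_penalty word_forms_total_power)
       (simp add: word_forms_def)
  then have "\<exists>t. H i j = word_form D t" for i j
    by (auto simp: word_forms_def)
  then obtain T where T: "\<And>i j. H i j = word_form D (T i j)"
    by metis
  define c' where "c' v u = (\<Sum>i\<in>UNIV. \<Sum>j\<in>UNIV. v i * T i j u * v j)" for v :: "'m \<Rightarrow> real" and u
  define V where "V = {v :: 'm \<Rightarrow> real. (\<Sum>i\<in>UNIV. (v i)\<^sup>2) = 1}"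
  define B where "B = (\<Sum>u\<in>words UNIV D. \<Sum>i\<in>UNIV. \<Sum>j\<in>UNIV. \<bar>T i j u\<bar>)"
  have c'_form: "word_form D (c' v) y = (\<Sum>i\<in>UNIV. \<Sum>j\<in>UNIV. v i * H i j y * v j)" for v y
  proof -
    have "c' v = (\<lambda>u. \<Sum>i\<in>UNIV. \<Sum>j\<in>UNIV. (v i * v j) * T i j u)"
      by (simp add: c'_def fun_eq_iff mult_ac)
    then show ?thesis
      by (simp add: word_form_sum word_form_cmult T mult_ac)
  qed
  obtain M where M: "M > D" "\<And>v w. v \<in> V \<Longrightarrow> (\<Sum>\<iota>\<in>injective_words M D. c' v (map w \<iota>)) \<ge> 0"
  proof (rule polya_uniform[of V D c' B \<epsilon>])
    fix v u assume v: "v \<in> V" and u: "length (u :: ('n \<times> 'n \<times> bool) list) = D"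
    have v1: "\<bar>v i\<bar> \<le> 1" for i
    proof -
      have "(v i)\<^sup>2 \<le> (\<Sum>i\<in>UNIV. (v i)\<^sup>2)"
        by (rule member_le_sum) auto
      then show ?thesis
        using v by (simp add: V_def abs_square_le_1)
    qed
    have "\<bar>c' v u\<bar> \<le> (\<Sum>i\<in>UNIV. \<Sum>j\<in>UNIV. \<bar>v i * T i j u * v j\<bar>)"
      unfolding c'_def by (rule order_trans[OF sum_abs sum_mono]) (rule sum_abs)
    also have "\<dots> \<le> (\<Sum>i\<in>UNIV. \<Sum>j\<in>UNIV. \<bar>T i j u\<bar>)"
    proof (intro sum_mono)
      fix i j
      have "\<bar>v i\<bar> * \<bar>v j\<bar> * \<bar>T i j u\<bar> \<le> 1 * 1 * \<bar>T i j u\<bar>"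
        by (intro mult_mono v1) auto
      then show "\<bar>v i * T i j u * v j\<bar> \<le> \<bar>T i j u\<bar>"
        by (simp add: abs_mult mult_ac)
    qed
    also have "\<dots> \<le> B"
      unfolding B_def
      by (intro member_le_sum[of u "words UNIV D" "\<lambda>u. \<Sum>i\<in>UNIV. \<Sum>j\<in>UNIV. \<bar>T i j u\<bar>"])
         (use u in \<open>auto intro: finite_words sum_nonneg simp: mem_words\<close>)
    finally show "\<bar>c' v u\<bar> \<le> B" .
  next
    fix v and y :: "'n \<times> 'n \<times> bool \<Rightarrow> real"
    assume v: "v \<in> V" and y: "\<And>k. 0 \<le> y k" "(\<Sum>k\<in>UNIV. y k) = 1"
    have "((\<chi> k. y k), (\<chi> i. v i)) \<in> S"
      using v y by (simp add: S_def V_def)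
    from C[OF this] have "\<epsilon> \<le> P y v + C * penalty \<delta> y"
      by (simp add: vec_lambda_inverse vec_nth_inverse)
    also have "\<dots> = P y v + (\<Sum>i\<in>UNIV. (v i)\<^sup>2) * (C * penalty \<delta> y)"
      using v by (simp add: V_def)
    also have "\<dots> = word_form D (c' v) y"
      by (simp add: c'_form H_def P_def \<sigma>_def y algebra_simps sum.distrib if_distrib[of "\<lambda>a. _ * a"]
          sum_distrib_left power2_eq_square cong: if_cong)
    finally show "\<epsilon> \<le> word_form D (c' v) y" .
  qed (use \<open>\<epsilon> > 0\<close> in \<open>auto intro: that\<close>)
  define J where "J = injective_words M D"
  define r where "r = M - D + 4"
  \<comment> \<open>\<open>card J\<close> expansions are averaged, and \<open>\<Sum>\<^sub>k y\<^sub>k = 4n |x|\<^sup>2\<close> for \<open>y = sq_coord x\<close>\<close>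
  define K where "K = real (card J) * (4 * real CARD('n)) ^ r"
  have "card J > 0"
    using card_injective_words_ge[of D M] M(1) unfolding J_def
    by (metis (no_types, opaque_lifting) less_le_trans of_nat_0_less_iff of_nat_less_iff
        less_imp_le diff_gt_0_iff_gt zero_less_power)
  then have "K > 0"
    by (simp add: K_def)
  define A where "A w i j = (\<Sum>\<iota>\<in>J. T i j (map w \<iota>)) / K" for w and i j :: 'm
  define lin where "lin = (\<lambda>(i, j, b). Var i + (if b then Var j else - Var j) :: 'n rpoly)"
  define q where "q w = (\<Prod>k<M. lin (w k))" for w
  have eval_lin: "(eval_poly x (lin k))\<^sup>2 = sq_coord x k" for x k
    using eval_poly_diff[of x 0] by (auto simp: lin_def sq_coord_def eval_poly_add split: prod.split)
  show ?thesis
  proof (rule that[where W = "Pi\<^sub>E {..<M} (\<lambda>_. UNIV)" and A = A and q = q and r = r])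
    show "finite (Pi\<^sub>E {..<M} (\<lambda>_. UNIV :: ('n \<times> 'n \<times> bool) set))"
      by (simp add: finite_PiE)
  next
    fix w and v :: "'m \<Rightarrow> real"
    have quad: "(\<Sum>i\<in>UNIV. \<Sum>j\<in>UNIV. v i * A w i j * v j) = (\<Sum>\<iota>\<in>J. c' v (map w \<iota>)) / K" for v
    proof -
      have "(\<Sum>\<iota>\<in>J. c' v (map w \<iota>)) = (\<Sum>i\<in>UNIV. \<Sum>j\<in>UNIV. \<Sum>\<iota>\<in>J. v i * T i j (map w \<iota>) * v j)"
        unfolding c'_def by (subst sum.swap) (subst (2) sum.swap, simp)
      then show ?thesis
        by (simp add: A_def sum_divide_distrib sum_distrib_left sum_distrib_right)
    qed
    show "(\<Sum>i\<in>UNIV. \<Sum>j\<in>UNIV. v i * A w i j * v j) \<ge> 0"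
    proof (cases "v = (\<lambda>_. 0)")
      case False
      define n where "n = (\<Sum>i\<in>UNIV. (v i)\<^sup>2)"
      have "n > 0"
        using False by (auto simp: n_def order_less_le sum_nonneg sum_nonneg_eq_0_iff fun_eq_iff)
      have "(\<lambda>i. v i / sqrt n) \<in> V"
        using \<open>n > 0\<close> by (simp add: V_def power_divide sum_divide_distrib[symmetric] n_def[symmetric])
      then have "0 \<le> (\<Sum>i\<in>UNIV. \<Sum>j\<in>UNIV. v i / sqrt n * A w i j * (v j / sqrt n))"
        using M(2) \<open>K > 0\<close> unfolding quad J_def by simp
      also have "\<dots> = (\<Sum>i\<in>UNIV. \<Sum>j\<in>UNIV. v i * A w i j * v j) / n"
        using \<open>n > 0\<close> by (simp add: sum_divide_distrib)
      finally show ?thesis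
        using \<open>n > 0\<close> by (simp add: zero_le_divide_iff)
    qed simp
  next
    fix x i j
    have "(\<Sum>w\<in>Pi\<^sub>E {..<M} (\<lambda>_. UNIV). A w i j * (eval_poly x (q w))\<^sup>2) =
        (\<Sum>\<iota>\<in>J. \<Sum>w\<in>Pi\<^sub>E {..<M} (\<lambda>_. UNIV). T i j (map w \<iota>) * (\<Prod>k<M. sq_coord x (w k))) / K"
      by (subst sum.swap) (simp add: A_def q_def eval_poly_prod prod_power_distrib eval_lin
          sum_distrib_right sum_divide_distrib)
    also have "\<dots> = (\<Sum>\<iota>\<in>J. H i j (sq_coord x) * \<sigma> (sq_coord x) ^ (M - D)) / K"
    proof (intro arg_cong2[where f = "(/)"] sum.cong refl)
      fix \<iota> assume "\<iota> \<in> J"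
      then have "distinct \<iota>" "set \<iota> \<subseteq> {..<M}" "length \<iota> = D"
        by (auto simp: J_def injective_words_def)
      then show "(\<Sum>w\<in>Pi\<^sub>E {..<M} (\<lambda>_. UNIV). T i j (map w \<iota>) * (\<Prod>k<M. sq_coord x (w k))) =
          H i j (sq_coord x) * \<sigma> (sq_coord x) ^ (M - D)"
        using sum_words_through_positions[of \<iota> "{..<M}" "T i j" "sq_coord x"] by (simp add: T \<sigma>_def)
    qed
    also have "\<dots> = card J * eval_poly x (F i j) * \<sigma> (sq_coord x) ^ r / K"
      by (simp add: H_def c r_def power_add mult_ac)
    also have "\<dots> = (\<Sum>k\<in>UNIV. (x k)\<^sup>2) ^ r * eval_poly x (F i j)"
      using \<open>card J > 0\<close> by (simp add: K_def \<sigma>_def sum_sq_coord power_mult_distrib)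
    finally show "(\<Sum>k\<in>UNIV. (x k)\<^sup>2) ^ r * eval_poly x (F i j) =
        (\<Sum>w\<in>Pi\<^sub>E {..<M} (\<lambda>_. UNIV). A w i j * (eval_poly x (q w))\<^sup>2)"
      by simp
  qed
qed

section \<open>Sums of squares and Gram matrices\<close>

lemma sum_rotate:
  "(\<Sum>i\<in>A. \<Sum>j\<in>B. \<Sum>k\<in>C. f i j k) = (\<Sum>k\<in>C. \<Sum>i\<in>A. \<Sum>j\<in>B. f i j k)"
proof -
  have "(\<Sum>i\<in>A. \<Sum>j\<in>B. \<Sum>k\<in>C. f i j k) = (\<Sum>i\<in>A. \<Sum>k\<in>C. \<Sum>j\<in>B. f i j k)"
    by (intro sum.cong refl sum.swap)
  then show ?thesis
    by (simp add: sum.swap[of _ C])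
qed

lemma sos_zero: "sos 0"
  unfolding sos_def by (rule exI[of _ "[]"]) simp

lemma sos_add:
  assumes "sos p" "sos q"
  shows "sos (p + q)"
proof -
  obtain ps qs where "p = (\<Sum>q\<leftarrow>ps. q\<^sup>2)" "q = (\<Sum>q\<leftarrow>qs. q\<^sup>2)"
    using assms unfolding sos_def by blast
  then show ?thesis
    unfolding sos_def by (intro exI[of _ "ps @ qs"]) simp
qed

lemma sos_square: "sos (q\<^sup>2)"
  unfolding sos_def by (rule exI[of _ "[q]"]) simp

lemma sos_sum: "(\<And>s. s \<in> S \<Longrightarrow> sos (f s)) \<Longrightarrow> sos (\<Sum>s\<in>S. f s)"
  by (induction S rule: infinite_finite_induct) (auto intro: sos_zero sos_add)

lemma eval_sos_nonneg: "sos p \<Longrightarrow> eval_poly a p \<ge> 0"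
  unfolding sos_def by (auto simp: eval_poly_sum_list eval_poly_power intro!: sum_list_nonneg)

lemma sos_imp_finite_sum:
  assumes "sos p"
  obtains N :: nat and q where "p = (\<Sum>k<N. (q k)\<^sup>2)"
proof -
  obtain qs where "p = (\<Sum>q\<leftarrow>qs. q\<^sup>2)"
    using assms unfolding sos_def by blast
  then have "p = (\<Sum>k<length qs. (qs ! k)\<^sup>2)"
    by (simp add: sum_list_sum_nth lessThan_atLeast0)
  then show ?thesis by (rule that)
qed

lemma mem_monomials_of_degree [simp]: "m \<in> monomials_of_degree d \<longleftrightarrow> mdeg m = d"
  by (simp add: monomials_of_degree_def)

lemma finite_monomials_of_degree: "finite (monomials_of_degree d :: 'v::finite monomial set)"
proof (rule finite_imageD)
  have "Poly_Mapping.lookup m i \<le> d" if "mdeg m = d" for m :: "'v monomial" and i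
    using member_le_sum[of i UNIV "Poly_Mapping.lookup m"] that by (simp add: mdeg_def)
  then have "Poly_Mapping.lookup ` (monomials_of_degree d :: 'v monomial set) \<subseteq> Pi\<^sub>E UNIV (\<lambda>_. {..d})"
    by auto
  then show "finite (Poly_Mapping.lookup ` (monomials_of_degree d :: 'v monomial set))"
    by (rule finite_subset) (simp add: finite_PiE)
  show "inj_on Poly_Mapping.lookup (monomials_of_degree d :: 'v monomial set)"
    by (intro inj_onI poly_mapping_eqI) simp
qed

definition hom_part :: "nat \<Rightarrow> 'v::finite rpoly \<Rightarrow> 'v rpoly" where
  "hom_part e q = (\<Sum>m\<in>monomials_of_degree e. Poly_Mapping.single m (Poly_Mapping.lookup q m))"

lemma lookup_sum_single:
  "finite S \<Longrightarrow> Poly_Mapping.lookup (\<Sum>m\<in>S. Poly_Mapping.single m (u m)) k = (if k \<in> S then u k else 0)"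
  by (auto simp: lookup_sum lookup_single when_def)

lemma lookup_hom_part:
  "Poly_Mapping.lookup (hom_part e q) m = (if mdeg m = e then Poly_Mapping.lookup q m else 0)"
  by (simp add: hom_part_def lookup_sum_single finite_monomials_of_degree)

text \<open>
  The restriction of \<open>q\<close> to the line through the origin in direction \<open>a\<close>, as a univariate polynomial.
  Its coefficients are the values of the homogeneous parts of \<open>q\<close> at \<open>a\<close>.
\<close>

definition ray_poly :: "('v::finite \<Rightarrow> real) \<Rightarrow> 'v rpoly \<Rightarrow> real poly" where
  "ray_poly a q = (\<Sum>m\<in>Poly_Mapping.keys q.
     monom (Poly_Mapping.lookup q m * (\<Prod>i\<in>UNIV. a i ^ Poly_Mapping.lookup m i)) (mdeg m))"

lemma poly_ray_poly: "poly (ray_poly a q) t = eval_poly (\<lambda>i. t * a i) q"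
  by (simp add: ray_poly_def poly_sum poly_monom eval_poly_def subst_poly_def power_mult_distrib
      prod.distrib mdeg_def power_sum mult_ac)

lemma coeff_ray_poly: "coeff (ray_poly a q) e = eval_poly a (hom_part e q)"
proof -
  have "eval_poly a (hom_part e q) = (\<Sum>m\<in>Poly_Mapping.keys q.
      Poly_Mapping.lookup (hom_part e q) m * (\<Prod>i\<in>UNIV. a i ^ Poly_Mapping.lookup m i))"
    by (rule eval_poly_superset) (auto simp: in_keys_iff lookup_hom_part split: if_splits)
  then show ?thesis
    by (auto simp: ray_poly_def coeff_sum lookup_hom_part intro!: sum.cong)
qed

lemma coeff_square_lowest:
  fixes U :: "real poly"
  assumes "\<And>a. a < l \<Longrightarrow> coeff U a = 0"
  shows "coeff (U\<^sup>2) (2 * l) = (coeff U l)\<^sup>2"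
proof -
  have "coeff (U\<^sup>2) (2 * l) = (\<Sum>a\<le>2 * l. coeff U a * coeff U (2 * l - a))"
    by (simp add: power2_eq_square coeff_mult)
  also have "\<dots> = (\<Sum>a\<le>2 * l. if a = l then (coeff U l)\<^sup>2 else 0)"
  proof (intro sum.cong refl)
    fix a assume "a \<in> {..2 * l}"
    then consider "a < l" | "a = l" | "2 * l - a < l" by fastforce
    then show "coeff U a * coeff U (2 * l - a) = (if a = l then (coeff U l)\<^sup>2 else 0)"
      using assms by cases (auto simp: power2_eq_square)
  qed
  finally show ?thesis by simp
qed

text \<open>
  Squares of real numbers cannot cancel: if \<open>l\<close> is the lowest degree in which some \<open>U i\<close> has a
  nonzero coefficient, then the sum of squares has a nonzero coefficient in degree \<open>2l\<close>, so
  \<open>l \<ge> e\<close>. Then degree \<open>2e\<close> receives contributions from the coefficients in degree \<open>e\<close> alone.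
\<close>

lemma sum_squares_eq_monom:
  fixes U :: "'i \<Rightarrow> real poly"
  assumes "finite I" and sum: "(\<Sum>i\<in>I. (U i)\<^sup>2) = monom b (2 * e)"
  shows "(\<Sum>i\<in>I. (coeff (U i) e)\<^sup>2) = b"
proof -
  have low: "\<forall>i\<in>I. coeff (U i) l = 0" if "l < e" for l
    using that
  proof (induction l rule: less_induct)
    case (less l)
    have "(\<Sum>i\<in>I. (coeff (U i) l)\<^sup>2) = (\<Sum>i\<in>I. coeff ((U i)\<^sup>2) (2 * l))"
      using less by (intro sum.cong refl coeff_square_lowest[symmetric]) auto
    also have "\<dots> = 0"
      using less.prems by (simp add: coeff_sum[symmetric] sum)
    finally show ?case
      using \<open>finite I\<close> by (simp add: sum_nonneg_eq_0_iff)
  qed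
  have "(\<Sum>i\<in>I. (coeff (U i) e)\<^sup>2) = (\<Sum>i\<in>I. coeff ((U i)\<^sup>2) (2 * e))"
    using low by (intro sum.cong refl coeff_square_lowest[symmetric]) auto
  also have "\<dots> = b"
    by (simp add: coeff_sum[symmetric] sum)
  finally show ?thesis .
qed

text \<open>
  Restricting to lines through the origin reduces this to one variable. It bounds the degrees of the
  squared polynomials, and hence the size of the Gram matrices, in terms of the degree of \<open>p\<close>.
\<close>

lemma sos_form_hom_part:
  fixes p :: "'v::finite rpoly"
  assumes "is_form (2 * e) p" and p: "p = (\<Sum>k<(N::nat). (q k)\<^sup>2)"
  shows "p = (\<Sum>k<N. (hom_part e (q k))\<^sup>2)"
proof (rule eval_poly_inject)
  fix a
  have "(\<Sum>k<N. (ray_poly a (q k))\<^sup>2) = monom (eval_poly a p) (2 * e)"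
  proof -
    have "poly (\<Sum>k<N. (ray_poly a (q k))\<^sup>2) t = poly (monom (eval_poly a p) (2 * e)) t" for t
    proof -
      have "poly (\<Sum>k<N. (ray_poly a (q k))\<^sup>2) t = eval_poly (\<lambda>i. t * a i) p"
        unfolding p by (simp add: poly_sum poly_ray_poly eval_poly_simps)
      also have "\<dots> = t ^ (2 * e) * eval_poly a p"
        by (rule eval_form_scale[OF assms(1)])
      finally show ?thesis by (simp add: poly_monom mult.commute)
    qed
    then show ?thesis
      by (simp flip: poly_eq_poly_eq_iff add: fun_eq_iff)
  qed
  from sum_squares_eq_monom[OF _ this]
  show "eval_poly a p = eval_poly a (\<Sum>k<N. (hom_part e (q k))\<^sup>2)"
    by (simp add: coeff_ray_poly eval_poly_simps)
qed

lemma gram_imp_psd: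
  assumes "\<And>i j. i < N \<Longrightarrow> j < N \<Longrightarrow> X i j = (\<Sum>k<(K::nat). L k i * L k j)"
  shows "psd N X"
  unfolding psd_def
proof (intro conjI allI impI)
  fix v :: "nat \<Rightarrow> real"
  have "(\<Sum>i<N. \<Sum>j<N. v i * X i j * v j) = (\<Sum>i<N. \<Sum>j<N. \<Sum>k<K. (v i * L k i) * (v j * L k j))"
    by (intro sum.cong refl) (simp add: assms sum_distrib_left sum_distrib_right mult_ac)
  also have "\<dots> = (\<Sum>k<K. (\<Sum>i<N. v i * L k i)\<^sup>2)"
    by (simp add: sum_rotate[where C = "{..<K}"] power2_eq_square sum_product)
  also have "\<dots> \<ge> 0"
    by (intro sum_nonneg) auto
  finally show "0 \<le> (\<Sum>i<N. \<Sum>j<N. v i * X i j * v j)" .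
qed (simp add: assms mult.commute)

text \<open>
  Writing \<open>\<Sum>\<^sub>k q\<^sub>k\<^sup>2\<close> with forms \<open>q\<^sub>k\<close> in terms of the vector \<open>z\<close> of monomials of degree \<open>e\<close> gives
  \<open>z\<^sup>T G z\<close> with \<open>G\<close> positive semidefinite; a factorisation of \<open>G\<close> leads back.
\<close>

lemma sos_iff_gram_matrix:
  fixes p :: "'v::finite rpoly"
  assumes form: "is_form (2 * e) p"
    and \<beta>: "bij_betw \<beta> {..<N} (monomials_of_degree e :: 'v monomial set)"
  shows "sos p \<longleftrightarrow> (\<exists>G. psd N G \<and> (\<forall>m\<in>monomials_of_degree (2 * e).
    (\<Sum>i<N. \<Sum>j<N. (if \<beta> i + \<beta> j = m then 1 else 0) * G i j) = Poly_Mapping.lookup p m))"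
    (is "_ \<longleftrightarrow> (\<exists>G. _ \<and> ?eqs G)")
proof -
  define gp where "gp G = (\<Sum>i<N. \<Sum>j<N. Poly_Mapping.single (\<beta> i + \<beta> j) (G i j))"
    for G :: "nat \<Rightarrow> nat \<Rightarrow> real"
  have deg: "mdeg (\<beta> i) = e" if "i < N" for i
    using bij_betwE[OF \<beta>] that by auto
  have lookup_gp: "Poly_Mapping.lookup (gp G) m =
      (\<Sum>i<N. \<Sum>j<N. (if \<beta> i + \<beta> j = m then 1 else 0) * G i j)" for G m
    unfolding gp_def lookup_sum by (intro sum.cong refl) (auto simp: lookup_single when_def)
  have form_gp: "is_form (2 * e) (gp G)" for G
    unfolding gp_def by (intro is_form_sum) (auto simp: is_form_def mdeg_add deg)
  have eqs: "?eqs G \<longleftrightarrow> p = gp G" for G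
  proof
    assume G: "?eqs G"
    show "p = gp G"
    proof (rule poly_mapping_eqI)
      fix m
      show "Poly_Mapping.lookup p m = Poly_Mapping.lookup (gp G) m"
      proof (cases "mdeg m = 2 * e")
        case True
        then show ?thesis
          using G by (simp add: lookup_gp)
      next
        case False
        then show ?thesis
          using form form_gp[of G] by (simp add: is_form_lookup)
      qed
    qed
  qed (simp add: lookup_gp)
  have gram_squares: "gp G = (\<Sum>k<K. (\<Sum>i<N. Poly_Mapping.single (\<beta> i) (L k i))\<^sup>2)"
    if "\<And>i j. i < N \<Longrightarrow> j < N \<Longrightarrow> G i j = (\<Sum>k<(K::nat). L k i * L k j)" for G K L
  proof -
    have "gp G = (\<Sum>i<N. \<Sum>j<N. \<Sum>k<K. Poly_Mapping.single (\<beta> i) (L k i) * Poly_Mapping.single (\<beta> j) (L k j))"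
      unfolding gp_def
    proof (intro sum.cong refl)
      fix i j assume "i \<in> {..<N}" "j \<in> {..<N}"
      then show "Poly_Mapping.single (\<beta> i + \<beta> j) (G i j) =
          (\<Sum>k<K. Poly_Mapping.single (\<beta> i) (L k i) * Poly_Mapping.single (\<beta> j) (L k j))"
        by (intro poly_mapping_eqI) (simp add: that mult_single lookup_sum lookup_single when_def)
    qed
    also have "\<dots> = (\<Sum>k<K. (\<Sum>i<N. Poly_Mapping.single (\<beta> i) (L k i))\<^sup>2)"
      by (simp add: sum_rotate[where C = "{..<K}"] power2_eq_square sum_product)
    finally show ?thesis .
  qed
  show ?thesis
  proof
    assume "sos p"
    then obtain K :: nat and q where "p = (\<Sum>k<K. (q k)\<^sup>2)"
      by (rule sos_imp_finite_sum)
    then have p: "p = (\<Sum>k<K. (hom_part e (q k))\<^sup>2)"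
      by (rule sos_form_hom_part[OF form])
    define L where "L k i = Poly_Mapping.lookup (q k) (\<beta> i)" for k i
    define G where "G i j = (\<Sum>k<K. L k i * L k j)" for i j
    have "hom_part e (q k) = (\<Sum>i<N. Poly_Mapping.single (\<beta> i) (L k i))" for k
      unfolding hom_part_def L_def by (rule sum.reindex_bij_betw[OF \<beta>, symmetric])
    then have "p = gp G"
      using p gram_squares[where G = G and K = K and L = L] by (simp add: G_def)
    moreover have "psd N G"
      by (rule gram_imp_psd[where L = L and K = K]) (simp add: G_def)
    ultimately show "\<exists>G. psd N G \<and> ?eqs G"
      using eqs by blast
  next
    assume "\<exists>G. psd N G \<and> ?eqs G"
    then obtain G where "psd N G" "p = gp G"
      using eqs by blast
    moreover obtain L where "\<forall>i<N. \<forall>j<N. G i j = (\<Sum>k<N. L k i * L k j)"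
      using psd_imp_gram[OF \<open>psd N G\<close>] by blast
    ultimately show "sos p"
      using gram_squares[where G = G and K = N and L = L] by (auto intro!: sos_sum sos_square)
  qed
qed

section \<open>Semidefinite representation\<close>

lemma hessian_form_diff: "hessian_form (f - g) = hessian_form f - hessian_form g"
  by (rule eval_poly_inject) (simp add: eval_hessian_form eval_poly_diff hess_quad_diff)

lemma hessian_form_add: "hessian_form (f + g) = hessian_form f + hessian_form g"
  by (rule eval_poly_inject) (simp add: eval_hessian_form eval_poly_add hess_quad_add)

lemma hessian_form_Const_mult: "hessian_form (Const c * f) = Const c * hessian_form f"
  by (rule eval_poly_inject) (simp add: eval_hessian_form eval_poly_mult hess_quad_Const_mult)

lemma is_form_hessian_form:
  assumes "is_form d g" "d \<ge> 2"
  shows "is_form d (hessian_form g)"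
  unfolding hessian_form_def
proof (intro is_form_sum)
  fix i j :: 'a
  have "is_form (d - 2) (hessian_poly g $ i $ j)"
    using is_form_partial_deriv[OF is_form_partial_deriv[OF assms(1)]]
    by (simp add: hessian_poly_def numeral_2_eq_2)
  from is_form_mult[OF is_form_mult[OF is_form_Var is_form_in_x[OF this]] is_form_Var]
  show "is_form d (Var (Inr i) * in_x (hessian_poly g $ i $ j) * Var (Inr j))"
    using assms(2) by (metis (no_types, lifting) One_nat_def Suc_1 add.commute diff_Suc_Suc
        le_add_diff_inverse plus_1_eq_Suc add_Suc add_Suc_right)
qed

text \<open>
  The polynomial whose being a sum of squares defines \<open>r\<close>-sos-convexity. It depends linearly on \<open>g\<close>.
\<close>

definition weighted_hessian_form :: "nat \<Rightarrow> 'n::finite rpoly \<Rightarrow> ('n + 'n) rpoly" where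
  "weighted_hessian_form r g = hessian_form g * in_x sq_norm_poly ^ r"

lemma weighted_hessian_form_diff:
  "weighted_hessian_form r (f - g) = weighted_hessian_form r f - weighted_hessian_form r g"
  by (simp add: weighted_hessian_form_def hessian_form_diff left_diff_distrib)

lemma weighted_hessian_form_Const_mult:
  "weighted_hessian_form r (Const c * g) = Const c * weighted_hessian_form r g"
  by (simp add: weighted_hessian_form_def hessian_form_Const_mult mult.assoc)

lemma weighted_hessian_form_sum:
  "weighted_hessian_form r (\<Sum>s\<in>S. f s) = (\<Sum>s\<in>S. weighted_hessian_form r (f s))"
proof (induction S rule: infinite_finite_induct)
  have "weighted_hessian_form r 0 = 0"
    using weighted_hessian_form_diff[of r 0 0] by simp
  then show "weighted_hessian_form r (\<Sum>s\<in>{}. f s) = (\<Sum>s\<in>{}. weighted_hessian_form r (f s))"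
    and "infinite S \<Longrightarrow> weighted_hessian_form r (\<Sum>s\<in>S. f s) = (\<Sum>s\<in>S. weighted_hessian_form r (f s))" for S
    by simp_all
qed (simp add: weighted_hessian_form_def hessian_form_add distrib_right)

lemma is_form_weighted_hessian_form:
  "is_form d g \<Longrightarrow> d \<ge> 2 \<Longrightarrow> is_form (d + 2 * r) (weighted_hessian_form r g)"
  unfolding weighted_hessian_form_def
  using is_form_power[OF is_form_in_x[OF is_form_sq_norm_poly], of r]
  by (intro is_form_mult is_form_hessian_form) (auto simp: mult.commute)

text \<open>
  The matrix variable has a block of size \<open>N0\<close> for the Gram matrix and a \<open>2 \<times> 2\<close> block for the unknown
  \<open>c\<close>. The equations compare the coefficients of \<open>z\<^sup>T G z\<close> with those of the weighted Hessian form,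
  which are linear in \<open>u\<close> and \<open>c\<close>. The strict inequality \<open>c > 0\<close> is not closed, so it is
  expressed by one further equation, which makes the off-diagonal entry of the \<open>2 \<times> 2\<close> block equal to \<open>1\<close>:
  a positive semidefinite block with diagonal \<open>c, t\<close> and off-diagonal entry \<open>1\<close> exists for
  some \<open>t\<close> precisely if \<open>c > 0\<close>.
\<close>

lemma sdp_representable_r_sos_convex:
  assumes "even d" "0 < d"
  shows "sdp_representable (monomials_of_degree d)
    {Poly_Mapping.lookup f | f :: 'n::finite rpoly. is_form d f \<and>
       (\<exists>c>0. r_sos_convex r (f - Const c * sq_norm_poly ^ (d div 2)))}"
    (is "sdp_representable ?K ?S")
proof -
  define e where "e = d div 2 + r"
  have e: "2 * e = d + 2 * r" and d2: "d \<ge> 2"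
    using assms by (auto simp: e_def elim!: evenE)
  define s where "s = (sq_norm_poly :: 'n rpoly) ^ (d div 2)"
  have form_s: "is_form d s"
    using is_form_sq_norm_poly_power[of "d div 2", where ?'n = 'n] assms(1) by (simp add: s_def)
  define T where "T = (weighted_hessian_form r :: 'n rpoly \<Rightarrow> _)"
  define N0 where "N0 = card (monomials_of_degree e :: ('n + 'n) monomial set)"
  define M0 where "M0 = card (monomials_of_degree (2 * e) :: ('n + 'n) monomial set)"
  obtain \<beta> where \<beta>: "bij_betw \<beta> {..<N0} (monomials_of_degree e :: ('n + 'n) monomial set)"
    using ex_bij_betw_nat_finite[OF finite_monomials_of_degree] by (auto simp: N0_def lessThan_atLeast0)
  obtain \<gamma> where \<gamma>: "bij_betw \<gamma> {..<M0} (monomials_of_degree (2 * e) :: ('n + 'n) monomial set)"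
    using ex_bij_betw_nat_finite[OF finite_monomials_of_degree] by (auto simp: M0_def lessThan_atLeast0)
  define P where "P u = (\<Sum>\<kappa>\<in>?K. Poly_Mapping.single \<kappa> (u \<kappa>))" for u :: "'n monomial \<Rightarrow> real"
  \<comment> \<open>equation \<open>k < M0\<close> compares coefficients at \<open>\<gamma> k\<close>, equation \<open>M0\<close> normalises the \<open>2 \<times> 2\<close> block\<close>
  define A where "A k i j = (if k < M0
      then (if i < N0 \<and> j < N0 \<and> \<beta> i + \<beta> j = \<gamma> k then 1 else 0)
        + (if i = N0 \<and> j = N0 then Poly_Mapping.lookup (T s) (\<gamma> k) else 0)
      else if i = N0 \<and> j = Suc N0 then 1 else (0::real))" for k i j
  define B where "B k \<kappa> = (if k < M0 then - Poly_Mapping.lookup (T (Poly_Mapping.single \<kappa> 1)) (\<gamma> k) else 0)"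
    for k \<kappa>
  define b where "b k = (if k < M0 then 0 else 1 :: real)" for k
  have S_iff: "u \<in> ?S \<longleftrightarrow> (\<forall>\<kappa>. \<kappa> \<notin> ?K \<longrightarrow> u \<kappa> = 0) \<and> (\<exists>c>0. sos (T (P u - Const c * s)))" for u
  proof
    assume "u \<in> ?S"
    then obtain f c where f: "u = Poly_Mapping.lookup f" "is_form d f" "c > 0"
      "r_sos_convex r (f - Const c * s)"
      by (auto simp: s_def)
    have "P u = f"
      using f(1,2) by (intro poly_mapping_eqI)
        (auto simp: P_def lookup_sum_single finite_monomials_of_degree is_form_lookup)
    then show "(\<forall>\<kappa>. \<kappa> \<notin> ?K \<longrightarrow> u \<kappa> = 0) \<and> (\<exists>c>0. sos (T (P u - Const c * s)))"
      using f by (auto simp: T_def weighted_hessian_form_def r_sos_convex_def is_form_lookup)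
  next
    assume u: "(\<forall>\<kappa>. \<kappa> \<notin> ?K \<longrightarrow> u \<kappa> = 0) \<and> (\<exists>c>0. sos (T (P u - Const c * s)))"
    then have "Poly_Mapping.lookup (P u) = u"
      by (auto simp: fun_eq_iff P_def lookup_sum_single finite_monomials_of_degree)
    moreover from this have "is_form d (P u)"
      using u by (auto simp: is_form_lookup)
    ultimately show "u \<in> ?S"
      using u by (auto simp: T_def weighted_hessian_form_def r_sos_convex_def s_def[symmetric]
          intro!: exI[of _ "P u"])
  qed
  have form_T: "is_form (2 * e) (T (P u - Const c * s))" for u c
  proof -
    have "is_form d (P u)"
      unfolding P_def by (intro is_form_sum) (auto simp: is_form_def)
    then have "is_form d (P u - Const c * s)"
      using is_form_diff is_form_mult[OF is_form_Const form_s] by auto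
    then show ?thesis
      unfolding e T_def by (rule is_form_weighted_hessian_form[OF _ d2])
  qed
  have lookup_T: "Poly_Mapping.lookup (T (P u - Const c * s)) m =
      (\<Sum>\<kappa>\<in>?K. u \<kappa> * Poly_Mapping.lookup (T (Poly_Mapping.single \<kappa> 1)) m) - c * Poly_Mapping.lookup (T s) m"
    for u c m
  proof -
    have single: "Poly_Mapping.single \<kappa> (u \<kappa>) = Const (u \<kappa>) * Poly_Mapping.single \<kappa> 1" for \<kappa>
      by (simp add: Const_def mult_single)
    show ?thesis
      unfolding T_def P_def weighted_hessian_form_diff weighted_hessian_form_sum single
        weighted_hessian_form_Const_mult lookup_minus lookup_sum lookup_Const_mult ..
  qed
  define gram where "gram X m = (\<Sum>i<N0. \<Sum>j<N0. (if \<beta> i + \<beta> j = m then 1 else 0) * X i j)"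
    for X :: "nat \<Rightarrow> nat \<Rightarrow> real" and m
  define eqs where "eqs X u \<longleftrightarrow> (\<forall>k<Suc M0.
      (\<Sum>i<Suc (Suc N0). \<Sum>j<Suc (Suc N0). A k i j * X i j) + (\<Sum>\<kappa>\<in>?K. B k \<kappa> * u \<kappa>) = b k)" for X u
  have sos_iff: "sos (T (P u - Const c * s)) \<longleftrightarrow> (\<exists>G. psd N0 G \<and>
      (\<forall>m\<in>monomials_of_degree (2 * e). gram G m = Poly_Mapping.lookup (T (P u - Const c * s)) m))"
    for u c
    unfolding gram_def by (rule sos_iff_gram_matrix[OF form_T \<beta>])
  have eqs_iff: "eqs X u \<longleftrightarrow> X N0 (Suc N0) = 1 \<and> (\<forall>m\<in>monomials_of_degree (2 * e).
      gram X m = Poly_Mapping.lookup (T (P u - Const (X N0 N0) * s)) m)" for X u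
  proof -
    have last: "(\<Sum>i<Suc (Suc N0). \<Sum>j<Suc (Suc N0). A M0 i j * X i j) +
        (\<Sum>\<kappa>\<in>?K. B M0 \<kappa> * u \<kappa>) = X N0 (Suc N0)"
      by (simp add: A_def B_def)
    have coef: "(\<Sum>i<Suc (Suc N0). \<Sum>j<Suc (Suc N0). A k i j * X i j) + (\<Sum>\<kappa>\<in>?K. B k \<kappa> * u \<kappa>) =
        gram X (\<gamma> k) - Poly_Mapping.lookup (T (P u - Const (X N0 N0) * s)) (\<gamma> k)" if "k < M0" for k
      unfolding lookup_T gram_def using that by (simp add: A_def B_def sum_negf mult.commute)
    have "eqs X u \<longleftrightarrow> X N0 (Suc N0) = 1 \<and>
        (\<forall>k<M0. gram X (\<gamma> k) = Poly_Mapping.lookup (T (P u - Const (X N0 N0) * s)) (\<gamma> k))"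
      unfolding eqs_def All_less_Suc last b_def by (auto simp: coef simp del: sum.lessThan_Suc)
    then show ?thesis
      unfolding bij_betw_imp_surj_on[OF \<gamma>, symmetric] by auto
  qed
  have "(\<exists>c>0. sos (T (P u - Const c * s))) \<longleftrightarrow> (\<exists>X. psd (Suc (Suc N0)) X \<and> eqs X u)" for u
  proof
    assume "\<exists>c>0. sos (T (P u - Const c * s))"
    then obtain c G where "c > 0" and G: "psd N0 G" "\<And>m. m \<in> monomials_of_degree (2 * e) \<Longrightarrow>
        gram G m = Poly_Mapping.lookup (T (P u - Const c * s)) m"
      unfolding sos_iff by blast
    define X where "X i j = (if i < N0 \<and> j < N0 then G i j else if i < N0 \<or> j < N0 then 0
        else if i = N0 \<and> j = N0 then c else if i = Suc N0 \<and> j = Suc N0 then 1 / c else 1)" for i j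
    have "psd (Suc (Suc N0)) X"
      unfolding psd_def
    proof (intro conjI allI impI)
      fix v :: "nat \<Rightarrow> real"
      have "(\<Sum>i<Suc (Suc N0). \<Sum>j<Suc (Suc N0). v i * X i j * v j) =
          (\<Sum>i<N0. \<Sum>j<N0. v i * G i j * v j) + (c * v N0 + v (Suc N0))\<^sup>2 / c"
        using \<open>c > 0\<close> by (simp add: X_def power2_eq_square field_simps)
      then show "0 \<le> (\<Sum>i<Suc (Suc N0). \<Sum>j<Suc (Suc N0). v i * X i j * v j)"
        using G(1) \<open>c > 0\<close> by (simp add: psd_def)
    qed (use G(1) in \<open>auto simp: X_def psd_def\<close>)
    moreover have "X N0 (Suc N0) = 1" "X N0 N0 = c" "gram X m = gram G m" for m
      by (auto simp: X_def gram_def)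
    ultimately show "\<exists>X. psd (Suc (Suc N0)) X \<and> eqs X u"
      using G(2) unfolding eqs_iff by (intro exI[of _ X]) simp
  next
    assume "\<exists>X. psd (Suc (Suc N0)) X \<and> eqs X u"
    then obtain X where X: "psd (Suc (Suc N0)) X" "X N0 (Suc N0) = 1"
      "\<forall>m\<in>monomials_of_degree (2 * e).
        gram X m = Poly_Mapping.lookup (T (P u - Const (X N0 N0) * s)) m"
      unfolding eqs_iff by blast
    obtain L where L: "\<forall>i<Suc (Suc N0). \<forall>j<Suc (Suc N0). X i j = (\<Sum>k<Suc (Suc N0). L k i * L k j)"
      using psd_imp_gram[OF X(1)] by blast
    have "psd N0 X"
      by (rule gram_imp_psd[where L = L and K = "Suc (Suc N0)"]) (use L in simp)
    moreover have "X N0 N0 > 0"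
    proof -
      have diag: "X N0 N0 = (\<Sum>k<Suc (Suc N0). (L k N0)\<^sup>2)"
        using L by (simp add: power2_eq_square)
      moreover have "X N0 N0 \<noteq> 0"
      proof
        assume "X N0 N0 = 0"
        then have "\<forall>k\<in>{..<Suc (Suc N0)}. (L k N0)\<^sup>2 = 0"
          unfolding diag by (subst (asm) sum_nonneg_eq_0_iff) auto
        then have "X N0 (Suc N0) = 0"
          using L by simp
        then show False using X(2) by simp
      qed
      ultimately show ?thesis
        by (metis order_less_le sum_nonneg zero_le_power2)
    qed
    ultimately show "\<exists>c>0. sos (T (P u - Const c * s))"
      using X(3) unfolding sos_iff by blast
  qed
  then have "?S = {u. (\<forall>\<kappa>. \<kappa> \<notin> ?K \<longrightarrow> u \<kappa> = 0) \<and> (\<exists>X. psd (Suc (Suc N0)) X \<and> eqs X u)}"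
    using S_iff by blast
  then show ?thesis
    unfolding sdp_representable_def eqs_def using finite_monomials_of_degree by blast
qed

section \<open>Positive definite Hessians\<close>

lemma sum_squares_pos_iff:
  "(\<Sum>i\<in>UNIV. (x i)\<^sup>2) > (0::real) \<longleftrightarrow> x \<noteq> (\<lambda>_. 0)" for x :: "'n::finite \<Rightarrow> real"
proof -
  have "(\<Sum>i\<in>UNIV. (x i)\<^sup>2) = 0 \<longleftrightarrow> x = (\<lambda>_. 0)"
    by (auto simp: sum_nonneg_eq_0_iff fun_eq_iff)
  then show ?thesis
    by (simp add: order_less_le sum_nonneg eq_commute[of 0])
qed

lemma continuous_on_hess_quad [continuous_intros]:
  assumes "\<And>i. continuous_on S (\<lambda>s. x s i)" "\<And>i. continuous_on S (\<lambda>s. v s i)"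
  shows "continuous_on S (\<lambda>s. hess_quad g (x s) (v s))"
  unfolding hess_quad_def by (intro continuous_intros assms)

lemma r_sos_convex_imp_hess_quad_nonneg:
  assumes "r_sos_convex r g" "x \<noteq> (\<lambda>_. 0)"
  shows "hess_quad g x v \<ge> 0"
proof -
  have "eval_poly (case_sum x v) (hessian_form g * in_x sq_norm_poly ^ r) \<ge> 0"
    using assms(1) by (intro eval_sos_nonneg) (simp add: r_sos_convex_def)
  then have "hess_quad g x v * (\<Sum>i\<in>UNIV. (x i)\<^sup>2) ^ r \<ge> 0"
    by (simp add: eval_poly_mult eval_poly_power eval_hessian_form eval_in_x eval_sq_norm_poly)
  moreover have "(\<Sum>i\<in>UNIV. (x i)\<^sup>2) ^ r > 0"
    using assms(2) by (simp add: sum_squares_pos_iff)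
  ultimately show ?thesis
    by (simp add: zero_le_mult_iff)
qed

lemma hess_quad_pos_if_r_sos_convex:
  assumes "c > 0" "k > 0" "r_sos_convex r (f - Const c * sq_norm_poly ^ k)"
    "x \<noteq> (\<lambda>_. 0)" "v \<noteq> (\<lambda>_. 0)"
  shows "hess_quad f x v > 0"
proof -
  have "hess_quad f x v - c * hess_quad (sq_norm_poly ^ k) x v \<ge> 0"
    using r_sos_convex_imp_hess_quad_nonneg[OF assms(3,4)]
    by (simp add: hess_quad_diff hess_quad_Const_mult)
  moreover have "c * hess_quad (sq_norm_poly ^ k) x v > 0"
    by (intro mult_pos_pos hess_quad_sq_norm_power_pos assms)
  ultimately show ?thesis by linarith
qed

text \<open>
  On the product of two unit spheres the quotient of the Hessian forms of \<open>f\<close> and \<open>|x|\<^sup>2\<^sup>k\<close> is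
  continuous and positive, so half of its minimum can serve as \<open>c\<close>. Homogeneity in \<open>x\<close> and in \<open>v\<close>
  extends the inequality from the spheres to all nonzero vectors.
\<close>

lemma hess_quad_margin:
  fixes f :: "'n::finite rpoly"
  assumes form: "is_form (2 * k) f" and "k > 0"
    and pos: "\<And>x v. x \<noteq> (\<lambda>_. 0) \<Longrightarrow> v \<noteq> (\<lambda>_. 0) \<Longrightarrow> hess_quad f x v > 0"
  obtains c where "c > 0"
    "\<And>x v. x \<noteq> (\<lambda>_. 0) \<Longrightarrow> v \<noteq> (\<lambda>_. 0) \<Longrightarrow> hess_quad (f - Const c * sq_norm_poly ^ k) x v > 0"
proof -
  define h where "h = hess_quad ((sq_norm_poly :: 'n rpoly) ^ k)"
  have h_pos: "h x v > 0" if "x \<noteq> (\<lambda>_. 0)" "v \<noteq> (\<lambda>_. 0)" for x v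
    unfolding h_def using hess_quad_sq_norm_power_pos[OF \<open>k > 0\<close> that] .
  define S where "S = sphere (0 :: real ^ 'n) 1 \<times> sphere (0 :: real ^ 'n) 1"
  have nz: "($) x \<noteq> (\<lambda>_. 0)" if "norm x = 1" for x :: "real ^ 'n"
  proof
    assume "($) x = (\<lambda>_. 0)"
    then have "x = 0" by (simp add: vec_eq_iff)
    with that show False by simp
  qed
  have "compact S" "S \<noteq> {}"
    by (auto simp: S_def compact_Times)
  moreover have "continuous_on S (\<lambda>s. hess_quad f (($) (fst s)) (($) (snd s)) / h (($) (fst s)) (($) (snd s)))"
    unfolding h_def
  proof (intro continuous_intros ballI)
    fix s assume "s \<in> S"
    then show "hess_quad (sq_norm_poly ^ k) (($) (fst s)) (($) (snd s)) \<noteq> 0"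
      using h_pos nz by (fastforce simp: S_def h_def[symmetric])
  qed
  ultimately obtain s0 where s0: "s0 \<in> S" and min: "\<And>s. s \<in> S \<Longrightarrow>
      hess_quad f (($) (fst s0)) (($) (snd s0)) / h (($) (fst s0)) (($) (snd s0)) \<le>
      hess_quad f (($) (fst s)) (($) (snd s)) / h (($) (fst s)) (($) (snd s))"
    using continuous_attains_inf[of S
        "\<lambda>s. hess_quad f (($) (fst s)) (($) (snd s)) / h (($) (fst s)) (($) (snd s))"] by blast
  define m where "m = hess_quad f (($) (fst s0)) (($) (snd s0)) / h (($) (fst s0)) (($) (snd s0))"
  have "m > 0"
    using s0 unfolding m_def S_def by (intro divide_pos_pos pos h_pos nz) auto
  show ?thesis
  proof (rule that[of "m / 2"])
    show "m / 2 > 0" using \<open>m > 0\<close> by simp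
    fix x v :: "'n \<Rightarrow> real" assume x: "x \<noteq> (\<lambda>_. 0)" and v: "v \<noteq> (\<lambda>_. 0)"
    define g where "g = f - Const (m / 2) * sq_norm_poly ^ k"
    have unit: "hess_quad g (($) y) (($) w) > 0" if "norm y = 1" "norm w = 1" for y w
    proof -
      have "m \<le> hess_quad f (($) y) (($) w) / h (($) y) (($) w)"
        using min[of "(y, w)"] that by (simp add: m_def S_def)
      moreover have hp: "h (($) y) (($) w) > 0"
        using h_pos nz that by blast
      ultimately have "m * h (($) y) (($) w) \<le> hess_quad f (($) y) (($) w)"
        by (simp add: pos_le_divide_eq)
      moreover have "m * h (($) y) (($) w) > 0"
        using hp \<open>m > 0\<close> by simp
      ultimately show ?thesis
        by (simp add: g_def hess_quad_diff hess_quad_Const_mult h_def[symmetric])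
    qed
    have norm_pos: "norm (\<chi> i. z i) > 0" if "z \<noteq> (\<lambda>_. 0)" for z :: "'n \<Rightarrow> real"
      using that by (auto simp: vec_eq_iff fun_eq_iff)
    have form_g: "is_form (2 * k) g"
      unfolding g_def using is_form_mult[OF is_form_Const is_form_sq_norm_poly_power]
      by (intro is_form_diff form) auto
    define a where "a = norm (\<chi> i. x i)"
    define b where "b = norm (\<chi> i. v i)"
    have ab: "a > 0" "b > 0"
      using norm_pos x v by (auto simp: a_def b_def)
    have nth: "($) ((1 / t) *\<^sub>R (\<chi> i. z i)) = (\<lambda>i. (1 / t) * z i)" for t and z :: "'n \<Rightarrow> real"
      by (simp add: fun_eq_iff)
    have "0 < hess_quad g (($) ((1 / a) *\<^sub>R (\<chi> i. x i))) (($) ((1 / b) *\<^sub>R (\<chi> i. v i)))"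
      using ab by (intro unit) (auto simp: a_def b_def)
    also have "\<dots> = (1 / a) ^ (2 * k - 2) * (1 / b)\<^sup>2 * hess_quad g x v"
      unfolding nth by (rule hess_quad_scale[OF form_g])
    finally have "hess_quad g x v > 0"
      by (rule zero_less_mult_pos) (use ab in simp)
    then show "hess_quad (f - Const (m / 2) * sq_norm_poly ^ k) x v > 0"
      by (simp add: g_def)
  qed
qed

text \<open>
  The matrix version of Reznick's theorem applied to the Hessian: each positive semidefinite
  coefficient matrix is a sum of squares of linear forms in \<open>v\<close>, hence the whole expression is a sum
  of squares of polynomials in \<open>(x, v)\<close>.
\<close>

lemma r_sos_convex_if_hess_quad_pos:
  fixes g :: "'n::finite rpoly"
  assumes form: "is_form (2 * k) g" and "k > 0"
    and pos: "\<And>x v. x \<noteq> (\<lambda>_. 0) \<Longrightarrow> v \<noteq> (\<lambda>_. 0) \<Longrightarrow> hess_quad g x v > 0"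
  shows "\<exists>r. r_sos_convex r g"
proof -
  define F where "F i j = partial_deriv i (partial_deriv j g)" for i j
  have F_form: "is_form (2 * (k - 1)) (F i j)" for i j
    using is_form_partial_deriv[OF is_form_partial_deriv[OF form], of i j]
    by (simp add: F_def right_diff_distrib' numeral_2_eq_2)
  have F_pos: "(\<Sum>i\<in>UNIV. \<Sum>j\<in>UNIV. v i * eval_poly x (F i j) * v j) > 0"
    if "x \<noteq> (\<lambda>_. 0)" "v \<noteq> (\<lambda>_. 0)" for x v
    using pos[OF that] by (simp add: F_def hess_quad_def)
  obtain r :: nat and W :: "(nat \<Rightarrow> 'n \<times> 'n \<times> bool) set" and q :: "_ \<Rightarrow> 'n rpoly"
    and A :: "_ \<Rightarrow> 'n \<Rightarrow> 'n \<Rightarrow> real"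
  where "finite W" and A: "\<And>w v. (\<Sum>i\<in>UNIV. \<Sum>j\<in>UNIV. v i * A w i j * v j) \<ge> 0"
    and F: "\<And>x i j. (\<Sum>k\<in>UNIV. (x k)\<^sup>2) ^ r * eval_poly x (F i j) =
      (\<Sum>w\<in>W. A w i j * (eval_poly x (q w))\<^sup>2)"
    by (rule positive_matrix_form_times_norm_power[of "k - 1" F, OF F_form F_pos])
      (assumption, assumption, rule that)
  have "\<exists>N L. \<forall>v. (\<Sum>i\<in>UNIV. \<Sum>j\<in>UNIV. v i * A w i j * v j) =
      (\<Sum>k<(N::nat). (\<Sum>i\<in>UNIV. L k i * v i)\<^sup>2)" for w
    by (rule nonneg_quadratic_form_is_sum_of_squares[OF A[where w = w]]) blast
  then obtain N :: "_ \<Rightarrow> nat" and L where L: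
    "\<And>w v. (\<Sum>i\<in>UNIV. \<Sum>j\<in>UNIV. v i * A w i j * v j) = (\<Sum>k<N w. (\<Sum>i\<in>UNIV. L w k i * v i)\<^sup>2)"
    by metis
  define p where "p w k = in_x (q w) * (\<Sum>i\<in>UNIV. Const (L w k i) * Var (Inr i))" for w k
  have "hessian_form g * in_x sq_norm_poly ^ r = (\<Sum>w\<in>W. \<Sum>k<N w. (p w k)\<^sup>2)"
  proof (rule eval_poly_inject)
    fix a :: "'n + 'n \<Rightarrow> real"
    define x where "x i = a (Inl i)" for i
    define v where "v i = a (Inr i)" for i
    have "eval_poly a (hessian_form g * in_x sq_norm_poly ^ r) =
        (\<Sum>i\<in>UNIV. \<Sum>j\<in>UNIV. v i * v j * ((\<Sum>k\<in>UNIV. (x k)\<^sup>2) ^ r * eval_poly x (F i j)))"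
      by (simp add: eval_poly_mult eval_poly_power eval_hessian_form eval_in_x eval_sq_norm_poly
          hess_quad_def F_def x_def[symmetric] v_def[symmetric] sum_distrib_left mult_ac)
    also have "\<dots> = (\<Sum>w\<in>W. (\<Sum>i\<in>UNIV. \<Sum>j\<in>UNIV. v i * A w i j * v j) * (eval_poly x (q w))\<^sup>2)"
      unfolding F sum_distrib_left sum_rotate[where C = W] sum_distrib_right
      by (intro sum.cong refl) (simp add: mult_ac)
    also have "\<dots> = eval_poly a (\<Sum>w\<in>W. \<Sum>k<N w. (p w k)\<^sup>2)"
      unfolding L sum_distrib_right by (simp add: p_def eval_poly_simps eval_in_x
          x_def[symmetric] v_def[symmetric] power_mult_distrib mult_ac)
    finally show "eval_poly a (hessian_form g * in_x sq_norm_poly ^ r) =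
        eval_poly a (\<Sum>w\<in>W. \<Sum>k<N w. (p w k)\<^sup>2)" .
  qed
  then have "r_sos_convex r g"
    by (simp add: r_sos_convex_def sos_sum sos_square)
  then show ?thesis ..
qed

theorem theorem6p4p20:
  fixes d :: nat
  assumes "even d" and "0 < d"
  shows "(\<forall>f :: 'n::finite rpoly. is_form d f \<longrightarrow>
            ((\<forall>x :: real ^ 'n. x \<noteq> 0 \<longrightarrow> pos_def (hessian f x)) \<longleftrightarrow>
             (\<exists>c>0. \<exists>r. r_sos_convex r (f - Const c * sq_norm_poly ^ (d div 2)))))
       \<and> (\<forall>r. sdp_representable (monomials_of_degree d)
            {Poly_Mapping.lookup f | f :: 'n rpoly. is_form d f \<and>
               (\<exists>c>0. r_sos_convex r (f - Const c * sq_norm_poly ^ (d div 2)))})"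
proof (intro conjI allI impI)
  fix f :: "'n rpoly" assume form: "is_form d f"
  define k where "k = d div 2"
  have d: "d = 2 * k" and "k > 0"
    using assms by (auto simp: k_def elim!: evenE)
  have vec_zero: "x = 0 \<longleftrightarrow> ($) x = (\<lambda>_. 0)" for x :: "real ^ 'n"
    by (auto simp: vec_eq_iff fun_eq_iff)
  have "(\<forall>x :: real ^ 'n. x \<noteq> 0 \<longrightarrow> pos_def (hessian f x)) \<longleftrightarrow>
      (\<forall>x v. x \<noteq> (\<lambda>_. 0) \<longrightarrow> v \<noteq> (\<lambda>_. 0) \<longrightarrow> hess_quad f x v > 0)" (is "?L \<longleftrightarrow> ?R")
  proof
    assume L: ?L
    show ?R
    proof (intro allI impI)
      fix x v :: "'n \<Rightarrow> real" assume "x \<noteq> (\<lambda>_. 0)" "v \<noteq> (\<lambda>_. 0)"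
      moreover have "($) (\<chi> i. z i) = z" for z :: "'n \<Rightarrow> real"
        by (simp add: fun_eq_iff)
      ultimately show "hess_quad f x v > 0"
        using L unfolding pos_def_hessian_iff vec_zero by metis
    qed
  qed (auto simp: pos_def_hessian_iff vec_zero)
  also have "\<dots> \<longleftrightarrow> (\<exists>c>0. \<exists>r. r_sos_convex r (f - Const c * sq_norm_poly ^ k))"
  proof
    assume ?R
    then obtain c where "c > 0" and c: "\<And>x v. x \<noteq> (\<lambda>_. 0) \<Longrightarrow> v \<noteq> (\<lambda>_. 0) \<Longrightarrow>
        hess_quad (f - Const c * sq_norm_poly ^ k) x v > 0"
      using hess_quad_margin[OF form[unfolded d] \<open>k > 0\<close>] by metis
    have "is_form (2 * k) (f - Const c * sq_norm_poly ^ k)"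
      using form is_form_mult[OF is_form_Const is_form_sq_norm_poly_power]
      by (intro is_form_diff) (auto simp: d)
    from r_sos_convex_if_hess_quad_pos[OF this \<open>k > 0\<close> c] \<open>c > 0\<close>
    show "\<exists>c>0. \<exists>r. r_sos_convex r (f - Const c * sq_norm_poly ^ k)" by blast
  qed (use hess_quad_pos_if_r_sos_convex \<open>k > 0\<close> in blast)
  finally show "(\<forall>x :: real ^ 'n. x \<noteq> 0 \<longrightarrow> pos_def (hessian f x)) \<longleftrightarrow>
      (\<exists>c>0. \<exists>r. r_sos_convex r (f - Const c * sq_norm_poly ^ (d div 2)))"
    by (simp add: k_def)
qed (rule sdp_representable_r_sos_convex[OF assms])

end
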